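(* Let $e\geqslant 2$ and let $$G=\langle a,b,y_1,\dots ,y_e\,|\,[a,b]uv\rangle,$$ where $[a,b]=a^{-1}b^{-1}ab$, and $u,v$ are nontrivial reduced words in the letters $y_1,\dots ,y_e$ such that $u$ and $v$ have no common letters (no generator $y_m$ occurs in both $u$ and $v$). Let $r,s\in G$ be two elements whose normal closures in $G$ coincide. Then $r$ is conjugate in $G$ to $s$ or to $s^{-1}$.
   Context: The commutator convention is $[g,h]=g^{-1}h^{-1}gh$. The normal closure of an element $g$ in a group $A$ is the smallest normal subgroup of $A$ containing $g$. *)

theory Defs
  imports "HOL-Algebra.Algebra"
begin

text \<open>Words in a free group: a letter is a pair (generator, flag); the flag True
  means the inverse of the generator.\<close>
type_synonym 'a word = "('a \<times> bool) list"

fun inv_letter :: "'a \<times> bool \<Rightarrow> 'a \<times> bool" where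
  "inv_letter (x, b) = (x, \<not> b)"

definition words_over :: "'a set \<Rightarrow> 'a word set" where
  "words_over S = {w. fst ` set w \<subseteq> S}"

definition reduced :: "'a word \<Rightarrow> bool" where
  "reduced w \<longleftrightarrow> (\<forall>i. Suc i < length w \<longrightarrow> w ! Suc i \<noteq> inv_letter (w ! i))"

inductive pres_eq :: "'a set \<Rightarrow> 'a word set \<Rightarrow> 'a word \<Rightarrow> 'a word \<Rightarrow> bool"
  for S R where
  refl: "w \<in> words_over S \<Longrightarrow> pres_eq S R w w"
| sym: "pres_eq S R v w \<Longrightarrow> pres_eq S R w v"
| trans: "pres_eq S R u v \<Longrightarrow> pres_eq S R v w \<Longrightarrow> pres_eq S R u w"
| cancel: "u \<in> words_over S \<Longrightarrow> v \<in> words_over S \<Longrightarrow> fst x \<in> S \<Longrightarrow>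
      pres_eq S R (u @ [x, inv_letter x] @ v) (u @ v)"
| relator: "u \<in> words_over S \<Longrightarrow> v \<in> words_over S \<Longrightarrow> r \<in> R \<Longrightarrow> r \<in> words_over S \<Longrightarrow>
      pres_eq S R (u @ r @ v) (u @ v)"

definition word_class :: "'a set \<Rightarrow> 'a word set \<Rightarrow> 'a word \<Rightarrow> 'a word set" where
  "word_class S R w = {w'. pres_eq S R w w'}"

definition presented_group :: "'a set \<Rightarrow> 'a word set \<Rightarrow> 'a word set monoid" where
  "presented_group S R =
     \<lparr>carrier = word_class S R ` words_over S,
      monoid.mult = (\<lambda>P Q. word_class S R ((SOME p. p \<in> P) @ (SOME q. q \<in> Q))),
      one = word_class S R []\<rparr>"

definition normal_closure :: "('g, 'b) monoid_scheme \<Rightarrow> 'g \<Rightarrow> 'g set" where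
  "normal_closure G g = \<Inter> {N. normal N G \<and> g \<in> N}"

definition conjugate_in :: "('g, 'b) monoid_scheme \<Rightarrow> 'g \<Rightarrow> 'g \<Rightarrow> bool" where
  "conjugate_in G r s \<longleftrightarrow> (\<exists>x \<in> carrier G. r = inv\<^bsub>G\<^esub> x \<otimes>\<^bsub>G\<^esub> s \<otimes>\<^bsub>G\<^esub> x)"

datatype gen = GA | GB | GY nat

definition gens :: "nat \<Rightarrow> gen set" where
  "gens e = {GA, GB} \<union> GY ` {1..e}"

definition comm_ab :: "gen word" where
  "comm_ab = [(GA, True), (GB, True), (GA, False), (GB, False)]"

end

theory Submission
  imports Defs "HOL-Library.Countable"
begin

text \<open>
  Put c = uv. The automorphisms of the free group on a, b given by b := a b and a := b a fix [a,b], so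
  the Euclidean algorithm reduces the theorem to the case that b has exponent sum zero in r, and hence
  in s. Conjugation by b then moves everything to the kernel K of the exponent sum in b: with
  a_i, y_i the conjugates of a, y by the i-th power of b, the group K is given by the relations
  a_i = a_(i-1) c_i. The window spanned by a_i, ..., a_(i+n) and the y_j with i < j <= i+n is a free
  factor of K with basis a_p and these y_j, for any p between i and i+n. Choose n minimal such that r
  is conjugate in K into a window of length n. By the Freiheitssatz, windows of length n - 1 embed into the one-relator
  quotient of a window of length n, so the quotient of K by all shifts of r is a chain of amalgamated
  products. Hence s has the same n as r, and r and s have the same normal closure in one common window,
  which is a free group, where Magnus' theorem applies. If n = 0, then r and s are conjugate to powers
  of a.

  The Freiheitssatz and Magnus' theorem for free groups are obtained from the same chain of amalgamated
  products, by induction on the length of the relator: choose a weight on the generators for which the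
  relator has weight zero, and lift to the corresponding infinite cyclic cover, collapsing the lifts of
  one generator.
\<close>

subsection \<open>Congruences on words\<close>

definition winv :: "'a word \<Rightarrow> 'a word" where
  "winv w = rev (map inv_letter w)"

abbreviation lets :: "'a word \<Rightarrow> 'a set" where
  "lets w \<equiv> fst ` set w"

lemma inv_letter_inv_letter [simp]: "inv_letter (inv_letter l) = l"
  by (cases l) simp

lemma fst_inv_letter [simp]: "fst (inv_letter l) = fst l"
  by (cases l) simp

lemma winv_simps [simp]:
  "winv [] = []" "winv (u @ v) = winv v @ winv u" "winv (l # w) = winv w @ [inv_letter l]"
  "winv (winv w) = w" "length (winv w) = length w"
  by (simp_all add: winv_def rev_map comp_def)

lemma lets_winv [simp]: "lets (winv w) = lets w"
  by (induction w) auto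

lemma words_over_UNIV [simp]: "w \<in> words_over UNIV"
  by (simp add: words_over_def)

definition eqr :: "'a word set \<Rightarrow> 'a word \<Rightarrow> 'a word \<Rightarrow> bool" where
  "eqr R = pres_eq UNIV R"

lemma eqr_refl [simp, intro]: "eqr R w w"
  by (simp add: eqr_def pres_eq.refl)

lemma eqr_sym: "eqr R v w \<Longrightarrow> eqr R w v"
  by (simp add: eqr_def pres_eq.sym)

lemma eqr_trans [trans]: "eqr R u v \<Longrightarrow> eqr R v w \<Longrightarrow> eqr R u w"
  unfolding eqr_def by (rule pres_eq.trans)

lemma eqr_cancel: "eqr R (u @ [l, inv_letter l] @ v) (u @ v)"
  unfolding eqr_def by (rule pres_eq.cancel) auto

lemma eqr_relator: "r \<in> R \<Longrightarrow> eqr R (u @ r @ v) (u @ v)"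
  unfolding eqr_def by (rule pres_eq.relator) auto

lemma eqr_rel: "r \<in> R \<Longrightarrow> eqr R r []"
  using eqr_relator[of r R "[]" "[]"] by simp

lemma eqr_induct [consumes 1, case_names refl sym trans cancel relator]:
  assumes "eqr R v w"
    and "\<And>w. P w w"
    and "\<And>v w. eqr R v w \<Longrightarrow> P v w \<Longrightarrow> P w v"
    and "\<And>u v w. eqr R u v \<Longrightarrow> P u v \<Longrightarrow> eqr R v w \<Longrightarrow> P v w \<Longrightarrow> P u w"
    and "\<And>u v l. P (u @ [l, inv_letter l] @ v) (u @ v)"
    and "\<And>u v r. r \<in> R \<Longrightarrow> P (u @ r @ v) (u @ v)"
  shows "P v w"
  using assms(1) unfolding eqr_def
proof (induction rule: pres_eq.induct)
  case (refl w) show ?case by (rule assms(2))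
next
  case (sym v w) then show ?case using assms(3)[of v w] by (simp add: eqr_def)
next
  case (trans u v w) then show ?case using assms(4)[of u v w] by (simp add: eqr_def)
next
  case (cancel u v l) show ?case by (rule assms(5))
next
  case (relator u v r) then show ?case by (intro assms(6))
qed

lemma eqr_context: "eqr R v w \<Longrightarrow> eqr R (p @ v @ q) (p @ w @ q)"
proof (induction rule: eqr_induct)
  case (cancel u v l)
  show ?case using eqr_cancel[of R "p @ u" l "v @ q"] by simp
next
  case (relator u v r)
  then show ?case using eqr_relator[of r R "p @ u" "v @ q"] by simp
qed (auto intro: eqr_sym eqr_trans)

lemma eqr_append: "eqr R u u' \<Longrightarrow> eqr R v v' \<Longrightarrow> eqr R (u @ v) (u' @ v')"
  using eqr_context[of R u u' "[]" v] eqr_context[of R v v' u' "[]"]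
  by (auto intro: eqr_trans)

lemma eqr_winv_right [simp]: "eqr R (w @ winv w) []"
proof (induction w)
  case (Cons l w)
  have "eqr R ([l] @ (w @ winv w) @ [inv_letter l]) ([l] @ [] @ [inv_letter l])"
    by (rule eqr_context[OF Cons.IH])
  also have "eqr R \<dots> []" using eqr_cancel[of R "[]" l "[]"] by simp
  finally show ?case by simp
qed simp

lemma eqr_winv_left [simp]: "eqr R (winv w @ w) []"
  using eqr_winv_right[of R "winv w"] by simp

lemma eqr_cancel_words: "eqr R (p @ w @ winv w @ q) (p @ q)" "eqr R (p @ winv w @ w @ q) (p @ q)"
  using eqr_context[OF eqr_winv_right[of R w], of p q] eqr_context[OF eqr_winv_left[of R w], of p q]
  by simp_all

lemma eqr_winv:
  assumes "eqr R v w" shows "eqr R (winv v) (winv w)"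
proof -
  have "eqr R (winv v) (winv v @ w @ winv w)"
    using eqr_sym[OF eqr_cancel_words(1)[of R "winv v" w "[]"]] by simp
  also have "eqr R \<dots> (winv v @ v @ winv w)"
    by (rule eqr_context[OF eqr_sym[OF assms]])
  also have "eqr R \<dots> (winv w)"
    using eqr_cancel_words(2)[of R "[]" v "winv w"] by simp
  finally show ?thesis .
qed

lemma eqr_iff_triv: "eqr R v w \<longleftrightarrow> eqr R (v @ winv w) []"
proof
  assume "eqr R v w"
  then have "eqr R (v @ winv w) (w @ winv w)" by (intro eqr_append eqr_refl)
  then show "eqr R (v @ winv w) []" by (rule eqr_trans) simp
next
  assume "eqr R (v @ winv w) []"
  then have "eqr R ((v @ winv w) @ w) ([] @ w)" by (intro eqr_append eqr_refl)
  moreover have "eqr R v (v @ winv w @ w)"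
    using eqr_sym[OF eqr_cancel_words(2)[of R v w "[]"]] by simp
  ultimately show "eqr R v w" by (auto intro: eqr_trans)
qed

lemma eqr_winv_append: "eqr R (winv u @ v) [] \<longleftrightarrow> eqr R u v"
proof -
  have "eqr R (winv v) (winv u) \<longleftrightarrow> eqr R u v"
    using eqr_winv[of R u v] eqr_winv[of R "winv v" "winv u"] eqr_sym by (auto intro: eqr_winv eqr_sym)
  then show ?thesis using eqr_iff_triv[of R "winv u" "winv v"] eqr_sym by auto
qed

lemma eqr_cancel_right: "eqr R (v @ k) (w @ k) \<Longrightarrow> eqr R v w"
proof -
  assume "eqr R (v @ k) (w @ k)"
  then have "eqr R ((v @ k) @ winv k) ((w @ k) @ winv k)"
    by (rule eqr_append[OF _ eqr_refl])
  moreover have "eqr R ((v @ k) @ winv k) v" "eqr R ((w @ k) @ winv k) w"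
    using eqr_cancel_words(1)[of R v k "[]"] eqr_cancel_words(1)[of R w k "[]"] by simp_all
  ultimately show ?thesis by (meson eqr_sym eqr_trans)
qed

lemma eqr_change_relators:
  assumes "eqr R v w" "\<And>r. r \<in> R \<Longrightarrow> eqr R' r []"
  shows "eqr R' v w"
  using assms(1)
proof (induction rule: eqr_induct)
  case (relator u v r)
  show ?case using eqr_context[OF assms(2)[OF relator], of u v] by simp
qed (auto intro: eqr_sym eqr_trans simp: eqr_cancel[simplified])

lemma eqr_mono: "eqr R v w \<Longrightarrow> R \<subseteq> R' \<Longrightarrow> eqr R' v w"
  by (erule eqr_change_relators) (auto intro: eqr_rel)

lemma eqr_free: "eqr {} v w \<Longrightarrow> eqr R v w"
  by (erule eqr_mono) simp

section \<open>Homomorphisms of free groups as substitutions\<close>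

definition sub :: "('a \<Rightarrow> 'b word) \<Rightarrow> 'a word \<Rightarrow> 'b word" where
  "sub f w = concat (map (\<lambda>(x, b). if b then winv (f x) else f x) w)"

lemma sub_simps [simp]:
  "sub f [] = []" "sub f (u @ v) = sub f u @ sub f v"
  "sub f ((x, b) # w) = (if b then winv (f x) else f x) @ sub f w"
  by (simp_all add: sub_def)

lemma sub_winv [simp]: "sub f (winv w) = winv (sub f w)"
  by (induction w) auto

lemma lets_sub: "lets (sub f w) = (\<Union>x\<in>lets w. lets (f x))"
proof (induction w)
  case (Cons l w)
  then show ?case by (cases l) (simp add: image_Un)
qed simp

lemma eqr_sub:
  assumes "eqr R v w" "\<And>r. r \<in> R \<Longrightarrow> eqr R' (sub f r) []"
  shows "eqr R' (sub f v) (sub f w)"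
  using assms(1)
proof (induction rule: eqr_induct)
  case (cancel u v l)
  obtain x b where l: "l = (x, b)" by (cases l)
  show ?case
    using eqr_cancel_words[of R' "sub f u" "f x" "sub f v"] l by simp
next
  case (relator u v r)
  show ?case using eqr_context[OF assms(2)[OF relator], of "sub f u" "sub f v"] by simp
qed (auto intro: eqr_sym eqr_trans)

lemma sub_cong: "(\<And>x. x \<in> lets w \<Longrightarrow> eqr R (f x) (g x)) \<Longrightarrow> eqr R (sub f w) (sub g w)"
proof (induction w)
  case (Cons l w)
  obtain x b where l: "l = (x, b)" by (cases l)
  have "eqr R (f x) (g x)" "eqr R (sub f w) (sub g w)" using Cons l by auto
  then show ?case using l by (auto intro: eqr_append eqr_winv)
qed simp

lemma sub_letter [simp]: "sub (\<lambda>x. [(x, False)]) w = w"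
  by (induction w) auto

lemma sub_sub: "sub g (sub f w) = sub (\<lambda>x. sub g (f x)) w"
  by (induction w) auto

text \<open>The retraction of the free group onto the free factor spanned by S; it serves to kill
  unwanted letters.\<close>

definition keepf :: "'a set \<Rightarrow> 'a \<Rightarrow> 'a word" where
  "keepf S x = (if x \<in> S then [(x, False)] else [])"

lemma sub_keepf: "sub (keepf S) w = filter (\<lambda>l. fst l \<in> S) w"
  by (induction w) (auto simp: keepf_def)

lemma sub_keepf_id [simp]: "lets w \<subseteq> S \<Longrightarrow> sub (keepf S) w = w"
  by (auto simp: sub_keepf filter_id_conv)

definition mapw :: "('a \<Rightarrow> 'b) \<Rightarrow> 'a word \<Rightarrow> 'b word" where
  "mapw f w = map (apfst f) w"

lemma mapw_simps [simp]: "mapw f [] = []" "mapw f (u @ v) = mapw f u @ mapw f v"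
  "mapw f ((x, b) # w) = (f x, b) # mapw f w" "length (mapw f w) = length w"
  "lets (mapw f w) = f ` lets w" "mapw g (mapw f w) = mapw (\<lambda>x. g (f x)) w"
  by (auto simp: mapw_def image_image)

lemma mapw_sub: "mapw f w = sub (\<lambda>x. [(f x, False)]) w"
  by (induction w) auto

lemma mapw_winv [simp]: "mapw f (winv w) = winv (mapw f w)"
  by (simp add: mapw_sub)

lemma mapw_id_on: "(\<And>x. x \<in> lets w \<Longrightarrow> f x = x) \<Longrightarrow> mapw f w = w"
  by (induction w) auto

lemma eqr_mapw: "eqr R v w \<Longrightarrow> eqr (mapw f ` R) (mapw f v) (mapw f w)"
  unfolding mapw_sub by (rule eqr_sub) (auto intro: eqr_rel)

section \<open>Conjugacy and cyclically minimal words\<close>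

definition conjw :: "'a word set \<Rightarrow> 'a word \<Rightarrow> 'a word \<Rightarrow> bool" where
  "conjw R v w \<longleftrightarrow> (\<exists>g. eqr R v (g @ w @ winv g))"

lemma conjwI: "eqr R v (g @ w @ winv g) \<Longrightarrow> conjw R v w"
  by (auto simp: conjw_def)

lemma eqr_imp_conjw: "eqr R v w \<Longrightarrow> conjw R v w"
  by (rule conjwI[of _ _ "[]"]) simp

lemma conjw_refl [simp]: "conjw R w w"
  by (simp add: eqr_imp_conjw)

lemma conjw_sym: assumes "conjw R v w" shows "conjw R w v"
proof -
  obtain g where g: "eqr R v (g @ w @ winv g)" using assms by (auto simp: conjw_def)
  have "eqr R (winv g @ v @ g) (winv g @ (g @ w @ winv g) @ g)" by (rule eqr_context[OF g])
  also have "eqr R \<dots> (w @ winv g @ g)" using eqr_cancel_words(2)[of R "[]" g "w @ winv g @ g"] by simp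
  also have "eqr R \<dots> w" using eqr_cancel_words(2)[of R w g "[]"] by simp
  finally show ?thesis by (intro conjwI[of _ _ "winv g"]) (simp add: eqr_sym)
qed

lemma conjw_trans [trans]: assumes "conjw R u v" "conjw R v w" shows "conjw R u w"
proof -
  obtain g h where "eqr R u (g @ v @ winv g)" "eqr R v (h @ w @ winv h)"
    using assms by (auto simp: conjw_def)
  then have "eqr R u (g @ (h @ w @ winv h) @ winv g)" by (metis eqr_context eqr_trans)
  then show ?thesis by (intro conjwI[of _ _ "g @ h"]) simp
qed

lemma conjw_winv: "conjw R v w \<Longrightarrow> conjw R (winv v) (winv w)"
  unfolding conjw_def by (metis eqr_winv winv_simps(2,4) append.assoc)

lemma conjw_mono: "conjw R v w \<Longrightarrow> R \<subseteq> R' \<Longrightarrow> conjw R' v w"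
  unfolding conjw_def by (auto intro: eqr_mono)

lemma conjw_free: "conjw {} v w \<Longrightarrow> conjw R v w"
  by (erule conjw_mono) simp

lemma conjw_sub:
  assumes "conjw R v w" "\<And>r. r \<in> R \<Longrightarrow> eqr R' (sub f r) []"
  shows "conjw R' (sub f v) (sub f w)"
proof -
  obtain g where "eqr R v (g @ w @ winv g)" using assms by (auto simp: conjw_def)
  from eqr_sub[OF this, of R' f] assms(2) show ?thesis by (intro conjwI[of _ _ "sub f g"]) simp
qed

lemma conjw_mapw: "conjw R v w \<Longrightarrow> conjw (mapw f ` R) (mapw f v) (mapw f w)"
  unfolding mapw_sub by (rule conjw_sub) (auto intro: eqr_rel)

lemma conjw_triv: assumes "conjw R v w" "eqr R w []" shows "eqr R v []"
proof -
  obtain g where g: "eqr R v (g @ w @ winv g)" using assms by (auto simp: conjw_def)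
  also have "eqr R \<dots> (g @ [] @ winv g)" by (rule eqr_context[OF assms(2)])
  also have "eqr R \<dots> []" by simp
  finally show ?thesis .
qed

lemma conjw_conj: "conjw R (g @ w @ winv g) w"
  by (rule conjwI[of _ _ g]) simp

text \<open>Takes the role of cyclic reduction; a word of minimal length among all free conjugates
  exists by well-ordering.\<close>

definition cycmin :: "'a word \<Rightarrow> bool" where
  "cycmin r \<longleftrightarrow> (\<forall>t. conjw {} r t \<longrightarrow> length r \<le> length t)"

lemma cycmin_exists: "\<exists>r'. conjw {} r r' \<and> cycmin r' \<and> length r' \<le> length r"
proof -
  obtain r' where r': "conjw {} r r'" "\<And>t. conjw {} r t \<Longrightarrow> length r' \<le> length t"
    using ex_has_least_nat[of "conjw {} r" r length] by auto
  from r'(1) have "\<And>t. conjw {} r' t \<Longrightarrow> conjw {} r t" by (rule conjw_trans)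
  with r' show ?thesis using conjw_refl[of "{}" r] unfolding cycmin_def by blast
qed

text \<open>Killing the letters that do not occur in t fixes t and sends r to another conjugate of
  t, which would be shorter than r if r had such a letter.\<close>

lemma cycmin_lets:
  assumes "cycmin r" "conjw {} r t" shows "lets r \<subseteq> lets t"
proof (rule ccontr)
  assume n: "\<not> lets r \<subseteq> lets t"
  let ?k = "sub (keepf (lets t))"
  have "conjw {} (?k r) (?k t)" by (rule conjw_sub[OF assms(2)]) simp
  then have "conjw {} r (?k r)" using assms(2) by (auto intro: conjw_trans conjw_sym)
  then have "length r \<le> length (?k r)" using assms(1) by (auto simp: cycmin_def)
  moreover have "length (?k r) < length r"
    using n unfolding sub_keepf by (auto intro!: length_filter_less)
  ultimately show False by simp
qed

lemma cycmin_triv: "cycmin r \<Longrightarrow> eqr {} r [] \<Longrightarrow> r = []"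
  unfolding cycmin_def by (metis eqr_imp_conjw le_zero_eq length_0_conv)

lemma cycmin_mapw:
  assumes "cycmin r" "inj f" shows "cycmin (mapw f r)"
  unfolding cycmin_def
proof (intro allI impI)
  fix t assume t: "conjw {} (mapw f r) t"
  let ?g = "inv_into UNIV f"
  have "conjw {} (mapw ?g (mapw f r)) (mapw ?g t)" using conjw_mapw[OF t, of ?g] by simp
  then have "conjw {} r (mapw ?g t)" using assms(2) by (simp add: mapw_id_on)
  then show "length (mapw f r) \<le> length t" using assms(1) by (auto simp: cycmin_def)
qed

subsection \<open>Amalgamation\<close>

text \<open>A representative chosen from the class, so that equality in the presented group becomes
  equality of words.\<close>

definition nf :: "'a word set \<Rightarrow> 'a word \<Rightarrow> 'a word" where
  "nf R w = (SOME v. eqr R w v)"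

lemma eqr_nf: "eqr R w (nf R w)"
  unfolding nf_def by (rule someI[of _ w]) simp

lemma nf_eq_iff: "nf R v = nf R w \<longleftrightarrow> eqr R v w"
proof
  assume "nf R v = nf R w"
  then show "eqr R v w" by (metis eqr_nf eqr_sym eqr_trans)
next
  assume "eqr R v w"
  then have "eqr R v = eqr R w" by (intro ext) (metis eqr_sym eqr_trans)
  then show "nf R v = nf R w" by (simp add: nf_def)
qed

lemma nf_nf [simp]: "nf R (nf R w) = nf R w"
  by (simp add: nf_eq_iff eqr_sym[OF eqr_nf])

lemma nf_append_nf [simp]: "nf R (u @ nf R w) = nf R (u @ w)"
  by (simp add: nf_eq_iff eqr_append eqr_sym[OF eqr_nf])

definition coset :: "'a set \<Rightarrow> 'a word set \<Rightarrow> 'a word \<Rightarrow> 'a word set" where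
  "coset C R w = {v. \<exists>h. lets h \<subseteq> C \<and> eqr R w (h @ v)}"

text \<open>The choice is made from the coset as a set, so it depends on w only through the right
  coset of the subgroup generated by C.\<close>

definition crep :: "'a set \<Rightarrow> 'a word set \<Rightarrow> 'a word \<Rightarrow> 'a word" where
  "crep C R w = (SOME v. v \<in> coset C R w)"

definition chead :: "'a set \<Rightarrow> 'a word set \<Rightarrow> 'a word \<Rightarrow> 'a word" where
  "chead C R w = (SOME h. lets h \<subseteq> C \<and> eqr R w (h @ crep C R w))"

lemma coset_self: "w \<in> coset C R w"
  unfolding coset_def by (rule CollectI, rule exI[of _ "[]"]) simp

lemma crep_in: "crep C R w \<in> coset C R w"
  unfolding crep_def by (rule someI[of _ w]) (rule coset_self)

lemma chead: "lets (chead C R w) \<subseteq> C" "eqr R w (chead C R w @ crep C R w)"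
proof -
  have "\<exists>h. lets h \<subseteq> C \<and> eqr R w (h @ crep C R w)"
    using crep_in[of C R w] by (simp add: coset_def)
  from someI_ex[OF this] show "lets (chead C R w) \<subseteq> C" "eqr R w (chead C R w @ crep C R w)"
    unfolding chead_def by auto
qed

lemma coset_mono:
  assumes "lets h \<subseteq> C" "eqr R v (h @ w)" shows "coset C R w \<subseteq> coset C R v"
proof
  fix x assume "x \<in> coset C R w"
  then obtain k where k: "lets k \<subseteq> C" "eqr R w (k @ x)" by (auto simp: coset_def)
  have "eqr R v (h @ k @ x)" by (rule eqr_trans[OF assms(2)]) (intro eqr_append eqr_refl k)
  then show "x \<in> coset C R v" unfolding coset_def
    using k assms by (intro CollectI exI[of _ "h @ k"]) (auto simp: image_Un)
qed

lemma crep_eq: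
  assumes "lets h \<subseteq> C" "eqr R v (h @ w)" shows "crep C R v = crep C R w"
proof -
  have "eqr R (winv h @ v) (winv h @ h @ w)" by (intro eqr_append eqr_refl assms)
  also have "eqr R \<dots> w" using eqr_cancel_words(2)[of R "[]" h w] by simp
  finally have "coset C R v \<subseteq> coset C R w"
    using assms(1) by (intro coset_mono[of "winv h"]) (auto intro: eqr_sym)
  with coset_mono[OF assms] show ?thesis by (simp add: crep_def)
qed

lemma crep_append: "lets h \<subseteq> C \<Longrightarrow> crep C R (h @ w) = crep C R w"
  by (rule crep_eq) auto

lemma crep_nf [simp]: "crep C R (nf R w) = crep C R w"
  by (rule crep_eq[of "[]"]) (simp_all add: eqr_sym[OF eqr_nf])

lemma crep_crep [simp]: "crep C R (crep C R w) = crep C R w"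
  using crep_eq[OF chead, of C R w] by simp

lemma chead_append:
  assumes "lets u \<subseteq> C" shows "eqr R (chead C R (nf R (u @ a))) (u @ chead C R a)"
proof (rule eqr_cancel_right)
  have "eqr R (chead C R (nf R (u @ a)) @ crep C R a) (nf R (u @ a))"
    using chead(2)[of R "nf R (u @ a)" C] assms by (simp add: crep_append eqr_sym)
  also have "eqr R \<dots> (u @ a)" by (rule eqr_sym[OF eqr_nf])
  also have "eqr R \<dots> (u @ chead C R a @ crep C R a)" by (intro eqr_append eqr_refl chead)
  finally show "eqr R (chead C R (nf R (u @ a)) @ crep C R a) ((u @ chead C R a) @ crep C R a)"
    by simp
qed

text \<open>With A and B the groups presented by Ra and Rb and C their common subgroup, this is the
  bijection A * (C/B) = C * (C/A) * (C/B) = B * (C/A), which is equivariant under C.\<close>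

definition swapf :: "'a set \<Rightarrow> 'a word set \<Rightarrow> 'a word set \<Rightarrow> 'a word \<times> 'a word \<Rightarrow> 'a word \<times> 'a word" where
  "swapf C Ra Rb = (\<lambda>(a, k). (nf Rb (chead C Ra a @ k), crep C Ra a))"

definition swap_dom :: "'a set \<Rightarrow> 'a word set \<Rightarrow> 'a word set \<Rightarrow> ('a word \<times> 'a word) set" where
  "swap_dom C Ra Rb = {(a, k). nf Ra a = a \<and> crep C Rb k = k}"

text \<open>The condition for amalgamation: the letters of C satisfy the same relations in both
  groups, hence generate a common subgroup.\<close>

definition agree_on :: "'a set \<Rightarrow> 'a word set \<Rightarrow> 'a word set \<Rightarrow> bool" where
  "agree_on C Ra Rb \<longleftrightarrow> (\<forall>w. lets w \<subseteq> C \<longrightarrow> (eqr Ra w [] \<longleftrightarrow> eqr Rb w []))"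

lemma agree_on_sym: "agree_on C Ra Rb \<Longrightarrow> agree_on C Rb Ra"
  by (auto simp: agree_on_def)

lemma agree_onD:
  assumes "agree_on C Ra Rb" "lets v \<subseteq> C" "lets w \<subseteq> C" "eqr Ra v w" shows "eqr Rb v w"
  using assms eqr_iff_triv[of Ra v w] eqr_iff_triv[of Rb v w]
  unfolding agree_on_def by (auto simp: image_Un)

lemma swapf_dom: "p \<in> swap_dom C Ra Rb \<Longrightarrow> swapf C Ra Rb p \<in> swap_dom C Rb Ra"
  by (auto simp: swap_dom_def swapf_def)

text \<open>The new first entry has coset representative k and head \<open>chead C Ra a\<close>
  modulo \<open>Rb\<close>. Agreement on C carries this head back to \<open>Ra\<close>, where head
  times representative is a again.\<close>

lemma swapf_swapf:
  assumes ag: "agree_on C Ra Rb" and p: "p \<in> swap_dom C Ra Rb"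
  shows "swapf C Rb Ra (swapf C Ra Rb p) = p"
proof -
  obtain a k where ak: "p = (a, k)" "nf Ra a = a" "crep C Rb k = k"
    using p by (auto simp: swap_dom_def)
  let ?b = "nf Rb (chead C Ra a @ k)"
  have t: "crep C Rb ?b = k" using ak chead(1)[of C Ra a] by (simp add: crep_append)
  have "eqr Rb (chead C Rb ?b @ k) (nf Rb (chead C Ra a @ k))"
    using chead(2)[of Rb ?b C] t by (simp add: eqr_sym)
  also have "eqr Rb \<dots> (chead C Ra a @ k)" by (rule eqr_sym[OF eqr_nf])
  finally have "eqr Rb (chead C Rb ?b) (chead C Ra a)" by (rule eqr_cancel_right)
  then have "eqr Ra (chead C Rb ?b) (chead C Ra a)"
    by (rule agree_onD[OF agree_on_sym[OF ag] chead(1) chead(1)])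
  then have "eqr Ra (chead C Rb ?b @ crep C Ra a) (chead C Ra a @ crep C Ra a)"
    by (intro eqr_append eqr_refl)
  also have "eqr Ra \<dots> a" by (rule eqr_sym[OF chead(2)])
  finally have "nf Ra (chead C Rb ?b @ crep C Ra a) = a" using ak(2) nf_eq_iff by metis
  then show ?thesis using ak t by (simp add: swapf_def)
qed

section \<open>The actions of the two factors on pairs\<close>

definition lact :: "'a word set \<Rightarrow> 'a word \<Rightarrow> 'a word \<times> 'a word \<Rightarrow> 'a word \<times> 'a word" where
  "lact R u = (\<lambda>(a, k). (nf R (u @ a), k))"

lemma lact_dom: "p \<in> swap_dom C Ra Rb \<Longrightarrow> lact Ra u p \<in> swap_dom C Ra Rb"
  by (auto simp: swap_dom_def lact_def)

lemma lact_append: "lact R (u @ v) p = lact R u (lact R v p)"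
  by (auto simp: lact_def split: prod.split)

lemma lact_eqr: "eqr R u v \<Longrightarrow> lact R u p = lact R v p"
  by (auto simp: lact_def nf_eq_iff eqr_append split: prod.split)

lemma lact_Nil: "p \<in> swap_dom C Ra Rb \<Longrightarrow> lact Ra [] p = p"
  by (auto simp: swap_dom_def lact_def)

lemma swapf_lact:
  assumes ag: "agree_on C Ra Rb" and u: "lets u \<subseteq> C"
  shows "swapf C Ra Rb (lact Ra u p) = lact Rb u (swapf C Ra Rb p)"
proof -
  obtain a k where ak: "p = (a, k)" by (cases p)
  have "eqr Rb (chead C Ra (nf Ra (u @ a))) (u @ chead C Ra a)"
    by (rule agree_onD[OF ag chead(1) _ chead_append[OF u]]) (use u chead(1)[of C Ra a] in \<open>simp add: image_Un\<close>)
  then have "nf Rb (chead C Ra (nf Ra (u @ a)) @ k) = nf Rb (u @ chead C Ra a @ k)"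
    by (metis nf_eq_iff eqr_append eqr_refl append.assoc)
  then show ?thesis using u by (simp add: ak lact_def swapf_def crep_append)
qed

text \<open>B acts by left multiplication on the pairs of the other kind; the bijection transports
  this action to the pairs on which A acts.\<close>

definition ract :: "'a set \<Rightarrow> 'a word set \<Rightarrow> 'a word set \<Rightarrow> 'a word \<Rightarrow> 'a word \<times> 'a word \<Rightarrow> 'a word \<times> 'a word" where
  "ract C Ra Rb u p = swapf C Rb Ra (lact Rb u (swapf C Ra Rb p))"

text \<open>Letters of T outside S act through B, all others through A. On common letters the choice
  is immaterial because the bijection is equivariant under C.\<close>

definition pact :: "'a set \<Rightarrow> 'a set \<Rightarrow> 'a word set \<Rightarrow> 'a word set \<Rightarrow> 'a word \<Rightarrow> 'a word \<times> 'a word \<Rightarrow> 'a word \<times> 'a word" where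
  "pact S T Ra Rb w p =
     foldr (\<lambda>l. if fst l \<in> T - S then ract (S \<inter> T) Ra Rb [l] else lact Ra [l]) w p"

lemma pact_simps [simp]: "pact S T Ra Rb [] p = p"
  "pact S T Ra Rb (u @ v) p = pact S T Ra Rb u (pact S T Ra Rb v p)"
  by (simp_all add: pact_def)

lemma pact_Cons: "pact S T Ra Rb (l # v) p = pact S T Ra Rb [l] (pact S T Ra Rb v p)"
  by (simp add: pact_def)

text \<open>Both groups act on the pairs, and the two actions agree on C. So words over all letters
  act in such a way that every relator acts trivially. Since A acts by left multiplication, a word
  over S that acts trivially is trivial in A.\<close>

theorem amalgam:
  fixes S T :: "'a set"
  assumes ag: "agree_on (S \<inter> T) Ra Rb"
    and Ra: "\<And>r. r \<in> Ra \<Longrightarrow> lets r \<subseteq> S" and Rb: "\<And>r. r \<in> Rb \<Longrightarrow> lets r \<subseteq> T"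
    and w: "lets w \<subseteq> S" and eq: "eqr (Ra \<union> Rb) w []"
  shows "eqr Ra w []"
proof -
  let ?C = "S \<inter> T" and ?D = "swap_dom (S \<inter> T) Ra Rb"
  let ?r = "ract ?C Ra Rb" and ?p = "pact S T Ra Rb"
  note sw = swapf_swapf[OF ag] and sw' = swapf_swapf[OF agree_on_sym[OF ag]]
  have r_dom: "?r u p \<in> ?D" if "p \<in> ?D" for u p
    unfolding ract_def by (intro swapf_dom lact_dom that)
  have r_append: "?r (u @ v) p = ?r u (?r v p)" if "p \<in> ?D" for u v p
    unfolding ract_def using sw'[OF lact_dom[OF swapf_dom[OF that]]] by (simp add: lact_append)
  have r_Nil: "?r [] p = p" if "p \<in> ?D" for p
    unfolding ract_def using that by (simp add: lact_Nil[OF swapf_dom] sw)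
  have r_eqr: "?r u p = ?r v p" if "eqr Rb u v" for u v p
    unfolding ract_def using lact_eqr[OF that] by simp
  \<comment> \<open>By equivariance, words over C act in the same way through A and through
    B.\<close>
  have r_lact: "?r u p = lact Ra u p" if "p \<in> ?D" "lets u \<subseteq> ?C" for u p
    unfolding ract_def using that by (simp add: swapf_lact[OF ag, symmetric] sw lact_dom)
  have p1_dom: "?p [l] p \<in> ?D" if "p \<in> ?D" for l p
    using that by (simp add: pact_def r_dom lact_dom)
  have p_dom: "?p u p \<in> ?D" if "p \<in> ?D" for u p
    using that by (induction u) (simp, subst pact_Cons, rule p1_dom)
  have p_S: "?p u p = lact Ra u p" if "p \<in> ?D" "lets u \<subseteq> S" for u p
    using that(2)
  proof (induction u)
    case (Cons l u)
    have "?p (l # u) p = lact Ra [l] (lact Ra u p)"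
      using Cons by (subst pact_Cons) (auto simp: pact_def)
    then show ?case by (simp add: lact_append[symmetric])
  qed (simp add: lact_Nil[OF that(1)])
  have p1_T: "?p [l] p = ?r [l] p" if "p \<in> ?D" "fst l \<in> T" for l p
    using that r_lact[of p "[l]"] by (auto simp: pact_def)
  have p_T: "?p u p = ?r u p" if "p \<in> ?D" "lets u \<subseteq> T" for u p
    using that(2)
  proof (induction u)
    case (Cons l u)
    have "?p (l # u) p = ?r [l] (?r u p)"
      using Cons that(1) by (subst pact_Cons) (auto simp: p1_T r_dom)
    then show ?case using that by (simp add: r_append[symmetric])
  qed (simp add: r_Nil[OF that(1)])
  have p_cancel: "?p [l, inv_letter l] p = p" if "p \<in> ?D" for l p
  proof -
    have e: "eqr R ([l] @ [inv_letter l]) []" for R using eqr_cancel[of R "[]" l "[]"] by simp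
    show ?thesis
    proof (cases "fst l \<in> T - S")
      case True
      have "?p [l, inv_letter l] p = ?r [l] (?r [inv_letter l] p)"
        using True by (simp add: pact_def)
      also have "\<dots> = p" using that r_append[OF that, of "[l]" "[inv_letter l]"] r_eqr[OF e] r_Nil by simp
      finally show ?thesis .
    next
      case False
      have "?p [l, inv_letter l] p = lact Ra [l] (lact Ra [inv_letter l] p)"
        using False by (auto simp: pact_def)
      also have "\<dots> = p"
        using lact_append[of Ra "[l]" "[inv_letter l]" p] lact_eqr[OF e, of Ra p] lact_Nil[OF that] by simp
      finally show ?thesis .
    qed
  qed
  have main: "eqr (Ra \<union> Rb) u v \<Longrightarrow> \<forall>p\<in>?D. ?p u p = ?p v p" for u v
  proof (induction rule: eqr_induct)
    case (cancel u v l)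
    show ?case unfolding pact_simps using p_cancel[OF p_dom] by metis
  next
    case (relator u v r)
    have "?p r p = p" if "p \<in> ?D" for p
      using relator
    proof
      assume "r \<in> Ra"
      then show ?thesis using that Ra p_S lact_eqr[OF eqr_rel, of r Ra p] lact_Nil by metis
    next
      assume "r \<in> Rb"
      then show ?thesis using that Rb p_T r_eqr[OF eqr_rel, of r p] r_Nil by metis
    qed
    then show ?case using p_dom by simp
  qed auto
  \<comment> \<open>Base point: the identity of A with the trivial coset. A word over S moves its
    first entry to the normal form of that word.\<close>
  let ?o = "(nf Ra [], crep ?C Rb [])"
  have "?o \<in> ?D" by (simp add: swap_dom_def)
  with main[OF eq] p_S[OF _ w] have "lact Ra w ?o = ?o" by auto
  then have "nf Ra w = nf Ra []" by (simp add: lact_def)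
  then show ?thesis by (simp add: nf_eq_iff)
qed

text \<open>A derivation uses only finitely many relators, hence only finitely many indices.\<close>

lemma eqr_words_bound:
  assumes "eqr (\<Union>i. R (i::int)) v w"
  shows "\<exists>N. \<forall>n\<ge>N. eqr (\<Union>i\<in>{-n..n}. R i) v w"
  using assms
proof (induction rule: eqr_induct)
  case (trans u v w)
  then obtain N M where "\<forall>n\<ge>N. eqr (\<Union>i\<in>{-n..n}. R i) u v" "\<forall>n\<ge>M. eqr (\<Union>i\<in>{-n..n}. R i) v w"
    by blast
  then show ?case by (intro exI[of _ "max N M"]) (auto intro: eqr_trans)
next
  case (cancel u v l)
  show ?case using eqr_cancel by blast
next
  case (relator u v r)
  then obtain i where "r \<in> R i" by auto
  then show ?case by (intro exI[of _ "\<bar>i\<bar>"] allI impI eqr_relator) (auto intro!: bexI[of _ i])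
qed (auto intro: eqr_sym)

text \<open>Adding the windows one after the other on the right yields a chain of amalgamated
  products.\<close>

theorem stagger:
  fixes S :: "int \<Rightarrow> 'a set" and R :: "int \<Rightarrow> 'a word set"
  assumes lets: "\<And>i r. r \<in> R i \<Longrightarrow> lets r \<subseteq> S i"
    and convex: "\<And>i j k. i \<le> k \<Longrightarrow> k \<le> j \<Longrightarrow> S i \<inter> S j \<subseteq> S k"
    and ag: "\<And>i. agree_on (S i \<inter> S (i + 1)) (R i) (R (i + 1))"
    and w: "lets w \<subseteq> S k" and eq: "eqr (\<Union>i. R i) w []"
  shows "eqr (R k) w []"
proof -
  let ?R = "\<lambda>i n. \<Union>j\<in>{i..i + int n}. R j" and ?S = "\<lambda>i n. \<Union>j\<in>{i..i + int n}. S j"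
  have main: "\<forall>k w. i \<le> k \<longrightarrow> k \<le> i + int n \<longrightarrow> lets w \<subseteq> S k \<longrightarrow> eqr (?R i n) w [] \<longrightarrow> eqr (R k) w []"
    for i n
  proof (induction n)
    case (Suc n)
    let ?j = "i + int n"
    have j: "{i..i + int (Suc n)} = insert (?j + 1) {i..?j}" by auto
    have RS: "?R i (Suc n) = ?R i n \<union> R (?j + 1)" "?S i (Suc n) = ?S i n \<union> S (?j + 1)"
      unfolding j by auto
    \<comment> \<open>Convexity: the new window meets the union of the earlier ones only inside its
      left neighbour.\<close>
    have cap: "?S i n \<inter> S (?j + 1) = S ?j \<inter> S (?j + 1)"
      using convex[of _ ?j "?j + 1"] by fastforce
    \<comment> \<open>The neighbour embeds into the chain by the induction hypothesis, so agreement
      with the chain reduces to agreement with the neighbour.\<close>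
    have ag': "agree_on (?S i n \<inter> S (?j + 1)) (?R i n) (R (?j + 1))"
      unfolding cap agree_on_def
    proof (intro allI impI)
      fix w :: "'a word" assume w: "lets w \<subseteq> S ?j \<inter> S (?j + 1)"
      have "eqr (?R i n) w [] \<longleftrightarrow> eqr (R ?j) w []"
        using Suc.IH w eqr_mono[of "R ?j" w "[]" "?R i n"] by fastforce
      also have "\<dots> \<longleftrightarrow> eqr (R (?j + 1)) w []" using ag[of ?j] w by (simp add: agree_on_def)
      finally show "eqr (?R i n) w [] \<longleftrightarrow> eqr (R (?j + 1)) w []" .
    qed
    have l1: "lets r \<subseteq> ?S i n" if "r \<in> ?R i n" for r using that lets by fast
    show ?case
    proof (intro allI impI)
      fix k w assume k: "i \<le> k" "k \<le> i + int (Suc n)" and w: "lets w \<subseteq> S k"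
        and eq: "eqr (?R i (Suc n)) w []"
      show "eqr (R k) w []"
      proof (cases "k = ?j + 1")
        case True
        show ?thesis
          using amalgam[of "S (?j + 1)" "?S i n" "R (?j + 1)" "?R i n" w] ag' l1 lets w eq True RS(1)
          by (simp add: Int_commute Un_commute agree_on_sym)
      next
        case False
        then have k': "k \<le> ?j" using k by simp
        have "eqr (?R i n) w []"
          by (rule amalgam[OF ag' l1 lets]) (use w k k' eq RS(1) in \<open>auto, fastforce\<close>)
        then show ?thesis using Suc.IH k k' w by blast
      qed
    qed
  qed auto
  obtain N where N: "\<forall>n\<ge>N. eqr (\<Union>i\<in>{-n..n}. R i) w []" using eqr_words_bound[OF eq] by blast
  define n where "n = nat (\<bar>N\<bar> + \<bar>k\<bar>)"
  have n: "N \<le> int n" "- int n \<le> k" "k \<le> int n" by (auto simp: n_def)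
  have e: "- int n + int (2 * n) = int n" by simp
  have "eqr (?R (- int n) (2 * n)) w []" unfolding e using N n(1) by blast
  then show ?thesis using main[of "- int n" "2 * n"] w n unfolding e by blast
qed

subsection \<open>Exponent sums and powers\<close>

definition wt :: "('a \<Rightarrow> int) \<Rightarrow> 'a word \<Rightarrow> int" where
  "wt \<phi> w = sum_list (map (\<lambda>(x, b). if b then - \<phi> x else \<phi> x) w)"

lemma wt_simps [simp]: "wt \<phi> [] = 0" "wt \<phi> (u @ v) = wt \<phi> u + wt \<phi> v"
  "wt \<phi> ((x, b) # w) = (if b then - \<phi> x else \<phi> x) + wt \<phi> w"
  by (simp_all add: wt_def)

lemma wt_winv [simp]: "wt \<phi> (winv w) = - wt \<phi> w"
  by (induction w) auto

lemma wt_sub: "wt \<phi> (sub f w) = wt (\<lambda>x. wt \<phi> (f x)) w"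
  by (induction w) auto

text \<open>With m = 0 this is invariance of the weight; other m compare exponents in
  \<open>magnus_cyclic\<close>.\<close>

lemma wt_eqr_dvd:
  assumes "eqr R v w" "\<And>r. r \<in> R \<Longrightarrow> m dvd wt \<phi> r" shows "m dvd wt \<phi> v - wt \<phi> w"
  using assms(1)
proof (induction rule: eqr_induct)
  case (sym v w)
  then show ?case by (simp add: dvd_diff_commute)
next
  case (trans u v w)
  then have "m dvd (wt \<phi> u - wt \<phi> v) + (wt \<phi> v - wt \<phi> w)" by (intro dvd_add)
  then show ?case by simp
next
  case (cancel u v l)
  then show ?case by (cases l) simp
next
  case (relator u v r)
  then show ?case using assms(2) by simp
qed simp

lemma wt_eqr: "eqr R v w \<Longrightarrow> (\<And>r. r \<in> R \<Longrightarrow> wt \<phi> r = 0) \<Longrightarrow> wt \<phi> v = wt \<phi> w"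
  using wt_eqr_dvd[of R v w 0 \<phi>] by simp

definition ind :: "'a \<Rightarrow> 'a \<Rightarrow> int" where
  "ind x y = (if y = x then 1 else 0)"

lemma ind_simps [simp]: "ind x x = 1" "y \<noteq> x \<Longrightarrow> ind x y = 0"
  by (simp_all add: ind_def)

lemma wt_ind_notin: "x \<notin> lets w \<Longrightarrow> wt (ind x) w = 0"
  by (induction w) (auto simp: ind_def)

lemma wt_add: "wt (\<lambda>y. a * \<phi> y + b * \<psi> y) w = a * wt \<phi> w + b * wt \<psi> w"
  by (induction w) (auto simp: algebra_simps)

section \<open>Powers of a generator\<close>

definition pw :: "'a \<Rightarrow> int \<Rightarrow> 'a word" where
  "pw x k = replicate (nat \<bar>k\<bar>) (x, k < 0)"

lemma pw_0 [simp]: "pw x 0 = []"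
  by (simp add: pw_def)

lemma winv_pw [simp]: "winv (pw x k) = pw x (- k)"
  by (cases "k = 0") (auto simp: pw_def winv_def)

lemma lets_pw: "lets (pw x k) \<subseteq> {x}"
  by (auto simp: pw_def)

lemma wt_pw [simp]: "wt \<phi> (pw x k) = k * \<phi> x"
  by (auto simp: pw_def wt_def sum_list_replicate)

lemma pw_Suc: "eqr R (pw x k @ [(x, False)]) (pw x (k + 1))"
proof (cases "k \<ge> 0")
  case True
  then have "nat \<bar>k + 1\<bar> = Suc (nat \<bar>k\<bar>)" by simp
  then show ?thesis using True by (simp add: pw_def replicate_append_same)
next
  case False
  then have "nat \<bar>k\<bar> = Suc (nat \<bar>k + 1\<bar>)" by simp
  then have "pw x k = pw x (k + 1) @ [(x, True)]"
    using False by (cases "k = - 1") (simp_all add: pw_def replicate_append_same)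
  then show ?thesis using eqr_cancel[of R "pw x (k + 1)" "(x, True)" "[]"] by simp
qed

lemma pw_pred: "eqr R (pw x k @ [(x, True)]) (pw x (k - 1))"
proof -
  have "eqr R (pw x k @ [(x, True)]) (pw x (k - 1) @ [(x, False)] @ [(x, True)])"
    using eqr_append[OF eqr_sym[OF pw_Suc[of R x "k - 1"]], of "[(x, True)]"] by simp
  also have "eqr R \<dots> (pw x (k - 1))"
    using eqr_cancel[of R "pw x (k - 1)" "(x, False)" "[]"] by simp
  finally show ?thesis .
qed

lemma eqr_pw:
  assumes "lets w \<subseteq> {x}" shows "eqr R (pw x k @ w) (pw x (k + wt (ind x) w))"
  using assms
proof (induction w arbitrary: k)
  case (Cons l w)
  obtain b where l: "l = (x, b)" using Cons.prems by (cases l) auto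
  let ?k = "if b then k - 1 else k + 1"
  have "eqr R ((pw x k @ [l]) @ w) (pw x ?k @ w)"
    using l pw_Suc[of R x k] pw_pred[of R x k] by (intro eqr_append eqr_refl) auto
  also have "eqr R \<dots> (pw x (?k + wt (ind x) w))" using Cons by simp
  finally show ?case using l by (simp add: algebra_simps split: if_splits)
qed simp

lemma eqr_pw_single: "lets w \<subseteq> {x} \<Longrightarrow> eqr R w (pw x (wt (ind x) w))"
  using eqr_pw[of w x R 0] by simp

text \<open>The weight must be positive on x so that the lifts of x can be collapsed. The hypothesis
  fails only if x alone has nonzero exponent sum; otherwise x has exponent sum zero or a second
  generator t can balance it.\<close>

lemma choose_weight:
  assumes "wt (ind x) r = 0 \<or> (\<exists>t. t \<noteq> x \<and> wt (ind t) r \<noteq> 0)"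
  shows "\<exists>\<phi>. \<phi> x > 0 \<and> wt \<phi> r = 0"
  using assms
proof
  assume "wt (ind x) r = 0"
  then show ?thesis by (intro exI[of _ "ind x"]) (simp add: ind_def)
next
  assume "\<exists>t. t \<noteq> x \<and> wt (ind t) r \<noteq> 0"
  then obtain t where t: "t \<noteq> x" "wt (ind t) r \<noteq> 0" by blast
  let ?s = "wt (ind t) r"
  let ?f = "\<lambda>y. \<bar>?s\<bar> * ind x y + (- (sgn ?s * wt (ind x) r)) * ind t y"
  have "wt ?f r = \<bar>?s\<bar> * wt (ind x) r - sgn ?s * wt (ind x) r * ?s"
    unfolding wt_add by simp
  also have "\<dots> = 0" by (simp add: abs_sgn mult_ac)
  finally show ?thesis using t by (intro exI[of _ ?f]) (simp add: ind_def)
qed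

subsection \<open>Lifting to a cyclic cover\<close>

text \<open>The weight \<open>\<phi>\<close> defines a homomorphism from the free group to the integers. A word is read
  as a path in the corresponding cyclic cover starting at height h; the letter \<open>(y, i)\<close> is the lift
  of the edge y that starts at height i, and the lifts of x are collapsed.\<close>

fun lift :: "'a \<Rightarrow> ('a \<Rightarrow> int) \<Rightarrow> int \<Rightarrow> 'a word \<Rightarrow> ('a \<times> int) word" where
  "lift x \<phi> h [] = []"
| "lift x \<phi> h ((y, b) # w) =
    (if y = x then [] else [((y, if b then h - \<phi> y else h), b)]) @
    lift x \<phi> (if b then h - \<phi> y else h + \<phi> y) w"

definition shift :: "int \<Rightarrow> ('a \<times> int) word \<Rightarrow> ('a \<times> int) word" where
  "shift k = mapw (\<lambda>p. (fst p, snd p + k))"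

lemma inj_shift: "inj (\<lambda>p. (fst p, snd p + k :: int))"
  by (auto simp: inj_def)

lemma shift_simps [simp]: "shift k [] = []" "shift k (u @ v) = shift k u @ shift k v"
  "shift k (shift j w) = shift (j + k) w" "shift k (winv w) = winv (shift k w)"
  "shift 0 w = w" "length (shift k w) = length w"
  by (simp_all add: shift_def ac_simps mapw_id_on)

lemma lets_shift: "(y, i) \<in> lets (shift k w) \<longleftrightarrow> (y, i - k) \<in> lets w"
proof -
  have "(y, i) \<in> lets (shift k w) \<longleftrightarrow> (y, i) \<in> (\<lambda>p. (fst p, snd p + k)) ` lets w"
    by (simp add: shift_def)
  also have "\<dots> \<longleftrightarrow> (y, i - k) \<in> lets w" by (force simp: image_def)
  finally show ?thesis .
qed

lemma lift_append: "lift x \<phi> h (u @ v) = lift x \<phi> h u @ lift x \<phi> (h + wt \<phi> u) v"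
  by (induction u arbitrary: h) (auto simp: algebra_simps)

lemma lift_shift: "lift x \<phi> (h + k) w = shift k (lift x \<phi> h w)"
proof (induction w arbitrary: h)
  case (Cons l w)
  obtain y b where l: "l = (y, b)" by (cases l)
  have "lift x \<phi> (h + k + d) w = shift k (lift x \<phi> (h + d) w)" for d
    using Cons[of "h + d"] by (simp add: algebra_simps)
  from this[of "\<phi> y"] this[of "- \<phi> y"] show ?case
    by (auto simp: l shift_def algebra_simps)
qed simp

lemma lift_eq_shift: "lift x \<phi> k w = shift k (lift x \<phi> 0 w)"
  using lift_shift[of x \<phi> 0 k w] by simp

lemma length_lift: "length (lift x \<phi> h w) \<le> length w"
  by (induction x \<phi> h w rule: lift.induct) auto

lemma length_lift_less: "x \<in> lets w \<Longrightarrow> length (lift x \<phi> h w) < length w"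
proof (induction w arbitrary: h)
  case (Cons l w)
  obtain y b where l: "l = (y, b)" by (cases l)
  show ?case
  proof (cases "y = x")
    case True
    then show ?thesis using length_lift[of x \<phi> _ w] by (simp add: l less_Suc_eq_le)
  next
    case False
    then show ?thesis using Cons by (auto simp: l)
  qed
qed simp

lemma lets_lift: "(y, i) \<in> lets (lift x \<phi> h w) \<Longrightarrow> y \<in> lets w \<and> y \<noteq> x"
  by (induction x \<phi> h w rule: lift.induct) (auto split: if_splits)

lemma lets_lift_height:
  assumes "\<And>z. z \<in> lets w \<Longrightarrow> \<phi> z = 0" "(y, i) \<in> lets (lift x \<phi> h w)" shows "i = h"
  using assms by (induction x \<phi> h w rule: lift.induct) (auto split: if_splits)

text \<open>A relator of weight zero lifts to a closed path, so deleting it leaves the height of the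
  remaining word unchanged. Each relator contributes one lift for every starting height.\<close>

lemma lift_eqr:
  assumes "eqr R v w" and wt: "\<And>r. r \<in> R \<Longrightarrow> wt \<phi> r = 0"
  shows "eqr (\<Union>r\<in>R. range (\<lambda>k. lift x \<phi> k r)) (lift x \<phi> h v) (lift x \<phi> h w)"
  using assms(1)
proof (induction arbitrary: h rule: eqr_induct)
  case (trans u v w)
  then show ?case by (meson eqr_trans)
next
  case (cancel u v l)
  obtain y b where l: "l = (y, b)" by (cases l)
  show ?case using eqr_cancel
    by (auto simp: l lift_append eqr_cancel[of _ _ "((_, _), False)", simplified] eqr_cancel[of _ _ "((_, _), True)", simplified])
next
  case (relator u v r)
  then show ?case by (auto simp: lift_append wt intro!: eqr_relator)
qed (auto intro: eqr_sym)

text \<open>Inverse to lifting: a power of x leads to height i, then y is read, and a power of x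
  leads back. Division rounds down; what matters is that adding \<open>\<phi> x\<close> to the
  height raises the quotient by one, so that the powers between consecutive letters cancel.\<close>

definition unlift :: "'a \<Rightarrow> ('a \<Rightarrow> int) \<Rightarrow> 'a \<times> int \<Rightarrow> 'a word" where
  "unlift x \<phi> = (\<lambda>(y, i). pw x (i div \<phi> x) @ [(y, False)] @ pw x (- ((i + \<phi> y) div \<phi> x)))"

lemma unlift_lift:
  assumes "\<phi> x > 0"
  shows "eqr R (sub (unlift x \<phi>) (lift x \<phi> h w))
    (pw x (h div \<phi> x) @ w @ pw x (- ((h + wt \<phi> w) div \<phi> x)))"
proof (induction w arbitrary: h)
  case Nil
  show ?case using eqr_sym[OF eqr_winv_right[of R "pw x (h div \<phi> x)"]] by simp
next
  case (Cons l w)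
  obtain y b where l: "l = (y, b)" by (cases l)
  define h' where "h' = (if b then h - \<phi> y else h + \<phi> y)"
  let ?q = "h div \<phi> x" and ?q' = "h' div \<phi> x"
  let ?r = "(h' + wt \<phi> w) div \<phi> x"
  have "eqr R (sub (unlift x \<phi>) (lift x \<phi> h [l])) (pw x ?q @ [l] @ pw x (- ?q'))"
  proof (cases "y = x")
    case True
    have q': "?q' = (if b then ?q - 1 else ?q + 1)"
      using assms True div_add_self2[of "\<phi> x" h] div_add_self2[of "\<phi> x" "h - \<phi> x"] by (auto simp: h'_def)
    have "eqr R ((pw x ?q @ [l]) @ pw x (- ?q')) (pw x ?q' @ pw x (- ?q'))"
      unfolding q' using True pw_Suc[of R x ?q] pw_pred[of R x ?q]
      by (intro eqr_append eqr_refl) (auto simp: l)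
    also have "eqr R \<dots> []" using eqr_winv_right[of R "pw x ?q'"] by simp
    finally show ?thesis using True l by (auto intro: eqr_sym)
  next
    case False
    then show ?thesis by (simp add: l unlift_def h'_def)
  qed
  then have "eqr R (sub (unlift x \<phi>) (lift x \<phi> h [l]) @ sub (unlift x \<phi>) (lift x \<phi> h' w))
    ((pw x ?q @ [l] @ pw x (- ?q')) @ pw x ?q' @ w @ pw x (- ?r))"
    by (intro eqr_append Cons.IH)
  also have "eqr R \<dots> (pw x ?q @ [l] @ w @ pw x (- ?r))"
    using eqr_cancel_words(2)[of R "pw x ?q @ [l]" "pw x ?q'" "w @ pw x (- ?r)"] by simp
  finally show ?case by (auto simp: l h'_def algebra_simps split: if_splits)
qed

lemma unlift_lift_0:
  assumes "\<phi> x > 0" "wt \<phi> w = 0" shows "eqr R (sub (unlift x \<phi>) (lift x \<phi> 0 w)) w"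
  using unlift_lift[where \<phi> = \<phi>, OF assms(1), of R 0 w] assms(2) by simp

lemma unlift_lift_conj:
  assumes "\<phi> x > 0" "wt \<phi> w = 0" shows "conjw R (sub (unlift x \<phi>) (lift x \<phi> h w)) w"
  using unlift_lift[where \<phi> = \<phi>, OF assms(1), of R h w] assms(2)
  by (intro conjwI[of _ _ "pw x (h div \<phi> x)"]) simp

lemma lets_unlift: "lets (unlift x \<phi> (y, i)) \<subseteq> {x, y}"
  using lets_pw[of x] by (fastforce simp: unlift_def image_Un)

subsection \<open>The Freiheitssatz\<close>

text \<open>A conjugation-invariant form of the condition that e occurs in the cyclic reduction of
  r.\<close>

definition essential :: "'a \<Rightarrow> 'a word \<Rightarrow> bool" where
  "essential e r \<longleftrightarrow> (\<forall>t. conjw {} r t \<longrightarrow> e \<in> lets t)"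

definition freiheit :: "'a word \<Rightarrow> bool" where
  "freiheit r \<longleftrightarrow> (\<forall>e w. essential e r \<longrightarrow> e \<notin> lets w \<longrightarrow> eqr {r} w [] \<longrightarrow> eqr {} w [])"

definition magnus :: "'a word \<Rightarrow> bool" where
  "magnus r \<longleftrightarrow> (\<forall>s. eqr {r} s [] \<longrightarrow> eqr {s} r [] \<longrightarrow> conjw {} s r \<or> conjw {} s (winv r))"

lemma freiheitD: "freiheit r \<Longrightarrow> essential e r \<Longrightarrow> e \<notin> lets w \<Longrightarrow> eqr {r} w [] \<Longrightarrow> eqr {} w []"
  by (auto simp: freiheit_def)

lemma cycmin_essential: "cycmin r \<Longrightarrow> e \<in> lets r \<Longrightarrow> essential e r"
  unfolding essential_def using cycmin_lets by blast

section \<open>Transfer along injective renamings\<close>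

definition unmap :: "('a \<Rightarrow> 'b) \<Rightarrow> 'b \<Rightarrow> 'a word" where
  "unmap f y = (if y \<in> range f then [(inv_into UNIV f y, False)] else [])"

lemma sub_unmap_mapw [simp]: "inj f \<Longrightarrow> sub (unmap f) (mapw f w) = w"
  by (induction w) (auto simp: unmap_def)

lemma lets_sub_unmap:
  assumes "inj f" "x \<in> lets (sub (unmap f) t)" shows "f x \<in> lets t"
proof -
  obtain y where y: "y \<in> lets t" "x \<in> lets (unmap f y)" using assms(2) unfolding lets_sub by blast
  then have "f x = y" using assms(1) by (auto simp: unmap_def split: if_splits)
  then show ?thesis using y by simp
qed

text \<open>The induction passes from words over \<open>'a\<close> to shorter words over
  \<open>'a \<times> int\<close>; an injection into the natural numbers returns to a fixed letter
  type. The left inverse \<open>unmap f\<close> kills the letters outside the range of f.\<close>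

lemma freiheit_inj:
  assumes "inj f" "freiheit (mapw f r)" shows "freiheit r"
  unfolding freiheit_def
proof (intro allI impI)
  fix e w assume ess: "essential e r" and w: "e \<notin> lets w" and eq: "eqr {r} w []"
  have "essential (f e) (mapw f r)" unfolding essential_def
  proof (intro allI impI)
    fix t assume "conjw {} (mapw f r) t"
    from conjw_sub[OF this, of "{}" "unmap f"] have "conjw {} r (sub (unmap f) t)" using assms(1) by simp
    then have "e \<in> lets (sub (unmap f) t)" using ess by (simp add: essential_def)
    then show "f e \<in> lets t" by (rule lets_sub_unmap[OF assms(1)])
  qed
  moreover have "f e \<notin> lets (mapw f w)" using w assms(1) by (simp add: inj_image_mem_iff)
  moreover have "eqr {mapw f r} (mapw f w) []" using eqr_mapw[OF eq, of f] by simp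
  ultimately have "eqr {} (mapw f w) []" by (rule freiheitD[OF assms(2)])
  from eqr_sub[OF this, of "{}" "unmap f"] show "eqr {} w []" using assms(1) by simp
qed

lemma magnus_inj:
  assumes "inj f" "magnus (mapw f r)" shows "magnus r"
  unfolding magnus_def
proof (intro allI impI)
  fix s assume "eqr {r} s []" "eqr {s} r []"
  from this[THEN eqr_mapw, of f] have "conjw {} (mapw f s) (mapw f r) \<or> conjw {} (mapw f s) (mapw f (winv r))"
    using assms(2) by (simp add: magnus_def)
  then show "conjw {} s r \<or> conjw {} s (winv r)"
    using conjw_sub[of "{}" "mapw f s" _ "{}" "unmap f"] assms(1) by (metis empty_iff sub_unmap_mapw)
qed

lemma eqr_conj_relator:
  assumes "eqr {r} s []" "conjw R r r'" "R \<subseteq> R'" "r' \<in> R'" shows "eqr R' s []"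
  using assms(1)
proof (rule eqr_change_relators)
  fix x assume "x \<in> {r}"
  then show "eqr R' x []"
    using conjw_triv[OF conjw_mono[OF assms(2,3)] eqr_rel[OF assms(4)]] by simp
qed

lemma eqr_conj_both:
  assumes "eqr {r} s []" "conjw {} r r'" "conjw {} s s'" shows "eqr {r'} s' []"
  using conjw_triv[OF conjw_free[OF conjw_sym[OF assms(3)]] eqr_conj_relator[OF assms(1,2)]] by simp

section \<open>Shifted lifts and windows\<close>

lemma conjw_shift: "conjw {} v w \<Longrightarrow> conjw {} (shift k v) (shift k w)"
  unfolding shift_def using conjw_mapw by force

lemma cycmin_shift: "cycmin r \<Longrightarrow> cycmin (shift k r)"
  unfolding shift_def by (rule cycmin_mapw[OF _ inj_shift])

lemma lift_eqr_shift:
  assumes eq: "eqr {r} w []" and wt: "wt \<phi> r = 0" and r': "conjw {} (lift x \<phi> 0 r) r'"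
    and w': "conjw {} (lift x \<phi> h w) w'"
  shows "eqr (range (\<lambda>k. shift k r')) w' []"
proof -
  have "eqr (\<Union>r\<in>{r}. range (\<lambda>k. lift x \<phi> k r)) (lift x \<phi> h w) (lift x \<phi> h [])"
    by (rule lift_eqr[OF eq]) (simp add: wt)
  then have "eqr (range (\<lambda>k. lift x \<phi> k r)) (lift x \<phi> h w) []" by simp
  then have "eqr (range (\<lambda>k. shift k r')) (lift x \<phi> h w) []"
  proof (rule eqr_change_relators)
    fix t assume "t \<in> range (\<lambda>k. lift x \<phi> k r)"
    then obtain k where "t = lift x \<phi> k r" by blast
    then have "conjw {} t (shift k r')" using conjw_shift[OF r', of k] lift_eq_shift[of x \<phi> k r] by simp
    then show "eqr (range (\<lambda>k. shift k r')) t []"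
      by (rule conjw_triv[OF conjw_free]) (simp add: eqr_rel)
  qed
  then show ?thesis by (rule conjw_triv[OF conjw_free[OF conjw_sym[OF w']]])
qed

lemma unlift_conj:
  assumes "\<phi> x > 0" "wt \<phi> r = 0" "conjw {} (lift x \<phi> 0 r) r'"
  shows "conjw {} r (sub (unlift x \<phi>) (shift k r'))"
proof -
  have "conjw {} (lift x \<phi> k r) (shift k r')"
    using conjw_shift[OF assms(3), of k] lift_eq_shift[of x \<phi> k r] by simp
  then have "conjw {} (sub (unlift x \<phi>) (lift x \<phi> k r)) (sub (unlift x \<phi>) (shift k r'))"
    by (rule conjw_sub) simp
  with unlift_lift_conj[where \<phi> = \<phi>, OF assms(1,2)] show ?thesis
    by (blast intro: conjw_trans conjw_sym)
qed

text \<open>Mapping t back to the base gives a conjugate of r, in which e must occur; the powers of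
  x added by \<open>unlift\<close> cannot supply it, since e differs from x.\<close>

lemma lift_essential:
  assumes "essential e r" "\<phi> x > 0" "wt \<phi> r = 0" "e \<noteq> x" "conjw {} (lift x \<phi> 0 r) t"
  shows "\<exists>i. (e, i) \<in> lets t"
proof -
  have "conjw {} r (sub (unlift x \<phi>) t)" using unlift_conj[where \<phi> = \<phi>, OF assms(2,3,5), of 0] by simp
  then have "e \<in> lets (sub (unlift x \<phi>) t)" using assms(1) by (simp add: essential_def)
  then obtain p where p: "p \<in> lets t" "e \<in> lets (unlift x \<phi> p)" unfolding lets_sub by blast
  then have "fst p = e" using lets_unlift[of x \<phi> "fst p" "snd p"] assms(4) by auto
  then show ?thesis using p by (cases p) auto
qed

lemma height_bounds:
  assumes "(e, i) \<in> lets (t :: ('a \<times> int) word)"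
  obtains m M where "(e, m) \<in> lets t" "(e, M) \<in> lets t" "\<And>i. (e, i) \<in> lets t \<Longrightarrow> m \<le> i \<and> i \<le> M"
proof -
  let ?I = "{i. (e, i) \<in> lets t}"
  have "?I \<subseteq> snd ` lets t" by (rule subsetI) (metis imageI mem_Collect_eq snd_conv)
  then have fin: "finite ?I" by (rule finite_subset) simp
  have "?I \<noteq> {}" using assms by auto
  then have "Min ?I \<in> ?I" "Max ?I \<in> ?I" using fin Min_in Max_in by blast+
  moreover have "Min ?I \<le> i \<and> i \<le> Max ?I" if "(e, i) \<in> lets t" for i
    using that fin by (intro conjI Min_le Max_ge) auto
  ultimately show thesis by (intro that[of "Min ?I" "Max ?I"]) blast+
qed

text \<open>A window restricts only the heights of the lifts of e, to their span in the shifted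
  relator. By the Freiheitssatz for the shifted relators, a word that misses an extreme lift of e is
  trivial only if it is freely trivial. So neighbouring windows agree, and \<open>stagger\<close>
  isolates a single relator.\<close>

lemma window_embed:
  fixes r :: "('a \<times> int) word"
  assumes cm: "cycmin r" and fs: "\<And>k. freiheit (shift k r)"
    and mM: "(e, m) \<in> lets r" "(e, M) \<in> lets r" "\<And>i. (e, i) \<in> lets r \<Longrightarrow> m \<le> i \<and> i \<le> M"
    and w: "\<And>i. (e, i) \<in> lets w \<Longrightarrow> m + k \<le> i \<and> i \<le> M + k"
    and eq: "eqr (range (\<lambda>k. shift k r)) w []"
  shows "eqr {shift k r} w []"
    and "(e, m + k) \<notin> lets w \<or> (e, M + k) \<notin> lets w \<Longrightarrow> eqr {} w []"
proof -
  define S where "S k = {p. fst p = e \<longrightarrow> m + k \<le> snd p \<and> snd p \<le> M + k}" for k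
  have ess: "essential (e, m + k) (shift k r)" "essential (e, M + k) (shift k r)" for k
    by (rule cycmin_essential[OF cycmin_shift[OF cm]], simp add: lets_shift mM)+
  have free: "eqr {} w []" if "eqr {shift k r} w []" "(e, m + k) \<notin> lets w \<or> (e, M + k) \<notin> lets w" for w k
    using that freiheitD[OF fs[of k] ess(1)] freiheitD[OF fs[of k] ess(2)] by blast
  show 1: "eqr {shift k r} w []"
  proof (rule stagger[where S = S and R = "\<lambda>k. {shift k r}"])
    fix i v assume "v \<in> {shift i r}"
    then have "p \<in> S i" if "p \<in> lets v" for p
      unfolding S_def
    proof (intro CollectI impI)
      assume "fst p = e"
      then have "(e, snd p - i) \<in> lets r" using that \<open>v \<in> _\<close> lets_shift[of e "snd p" i r] by (cases p) simp
      from mM(3)[OF this] show "m + i \<le> snd p \<and> snd p \<le> M + i" by simp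
    qed
    then show "lets v \<subseteq> S i" by blast
  next
    fix i j k :: int assume "i \<le> k" "k \<le> j"
    then show "S i \<inter> S j \<subseteq> S k" by (auto simp: S_def)
  next
    \<comment> \<open>The overlap misses the lowest lift of e in the first relator and the highest
      one in the second, so neither relator imposes a relation on it.\<close>
    fix i show "agree_on (S i \<inter> S (i + 1)) {shift i r} {shift (i + 1) r}" unfolding agree_on_def
    proof (intro allI impI)
      fix v :: "('a \<times> int) word" assume v: "lets v \<subseteq> S i \<inter> S (i + 1)"
      have "eqr {shift i r} v [] \<longleftrightarrow> eqr {} v []"
        using free[of i v] v eqr_free by (fastforce simp: S_def)
      moreover have "eqr {shift (i + 1) r} v [] \<longleftrightarrow> eqr {} v []"
        using free[of "i + 1" v] v eqr_free by (fastforce simp: S_def)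
      ultimately show "eqr {shift i r} v [] \<longleftrightarrow> eqr {shift (i + 1) r} v []" by simp
    qed
  next
    show "lets w \<subseteq> S k"
    proof
      fix p assume "p \<in> lets w"
      then show "p \<in> S k" unfolding S_def by (metis (mono_tags, lifting) mem_Collect_eq prod.collapse w)
    qed
  next
    show "eqr (\<Union>i. {shift i r}) w []" using eq by (simp add: UNION_singleton_eq_range)
  qed
  show "(e, m + k) \<notin> lets w \<or> (e, M + k) \<notin> lets w \<Longrightarrow> eqr {} w []" by (rule free[OF 1])
qed

lemma lift_mapw_fst:
  assumes "\<And>y i. (y, i) \<in> lets w \<Longrightarrow> i = h \<and> y \<noteq> x \<and> \<phi> y = 0"
  shows "lift x \<phi> h (mapw fst w) = w"
  using assms
proof (induction w)
  case (Cons l w)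
  obtain y i b where l: "l = ((y, i), b)" by (metis surj_pair)
  have "i = h \<and> y \<noteq> x \<and> \<phi> y = 0" by (rule Cons.prems) (simp add: l)
  moreover have "lift x \<phi> h (mapw fst w) = w" by (rule Cons.IH, rule Cons.prems) simp
  ultimately show ?case by (simp add: l)
qed simp

text \<open>If r involves only e, killing e suffices. Otherwise, passing to a cover in which a
  generator of r is collapsed shortens the relator. Words without e lift to words that fit into one
  window and miss an extreme letter of the relator, so \<open>window_embed\<close> makes them freely
  trivial.\<close>

lemma freiheit_step:
  fixes r :: "'a word"
  assumes IH: "\<And>r' :: ('a \<times> int) word. length r' < length r \<Longrightarrow> freiheit r'"
  shows "freiheit r"
  unfolding freiheit_def
proof (intro allI impI)
  fix e w assume ess: "essential e r" and w: "e \<notin> lets w" and eq: "eqr {r} w []"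
  have conj_e: "e \<in> lets t" if "conjw {} r t" for t using ess that by (simp add: essential_def)
  have er: "e \<in> lets r" by (rule conj_e) simp
  let ?good = "\<lambda>x. wt (ind x) r = 0 \<or> (\<exists>t. t \<noteq> x \<and> wt (ind t) r \<noteq> 0)"
  have wt_w: "wt \<phi> w = 0" if "wt \<phi> r = 0" for \<phi> using wt_eqr[OF eq, of \<phi>] that by simp
  have fin: "eqr {} w []" if "\<phi> x > 0" "wt \<phi> r = 0" "eqr {} (lift x \<phi> 0 w) []" for x \<phi>
  proof -
    have "eqr {} w (sub (unlift x \<phi>) (lift x \<phi> 0 w))"
      by (rule eqr_sym[OF unlift_lift_0[where \<phi> = \<phi>, OF that(1) wt_w[OF that(2)]]])
    also have "eqr {} \<dots> (sub (unlift x \<phi>) [])" by (rule eqr_sub[OF that(3)]) simp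
    finally show ?thesis by simp
  qed
  \<comment> \<open>In the third case each generator of r other than e is the only one with nonzero
    exponent sum. Hence r involves only e and x, and e has exponent sum zero.\<close>
  consider "lets r \<subseteq> {e}" | x where "x \<in> lets r" "x \<noteq> e" "?good x"
    | x where "x \<in> lets r" "x \<noteq> e" "\<not> ?good x" "\<And>y. y \<in> lets r \<Longrightarrow> y \<noteq> e \<Longrightarrow> \<not> ?good y"
    by blast
  then show "eqr {} w []"
  proof cases
    case 1
    have "eqr {} (sub (keepf (- {e})) w) (sub (keepf (- {e})) [])"
    proof (rule eqr_sub[OF eq])
      fix t assume "t \<in> {r}"
      then have "sub (keepf (- {e})) t = []" using 1 by (auto simp: sub_keepf filter_empty_conv)
      then show "eqr {} (sub (keepf (- {e})) t) []" by simp
    qed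
    moreover have "sub (keepf (- {e})) w = w" using w by (intro sub_keepf_id) blast
    ultimately show ?thesis by simp
  next
    case (2 x)
    then obtain \<phi> where \<phi>: "\<phi> x > 0" "wt \<phi> r = 0" using choose_weight[OF 2(3)] by blast
    obtain r' where r': "conjw {} (lift x \<phi> 0 r) r'" "cycmin r'" "length r' \<le> length (lift x \<phi> 0 r)"
      using cycmin_exists by blast
    have len: "length (shift k r') < length r" for k
      using r'(3) length_lift_less[OF 2(1), of \<phi> 0] by simp
    obtain i where "(e, i) \<in> lets r'"
      using lift_essential[where \<phi> = \<phi>, OF ess \<phi> 2(2)[symmetric] r'(1)] by blast
    then obtain m M where mM: "(e, m) \<in> lets r'" "(e, M) \<in> lets r'"
      "\<And>i. (e, i) \<in> lets r' \<Longrightarrow> m \<le> i \<and> i \<le> M" by (rule height_bounds) blast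
    have no: "(e, i) \<notin> lets (lift x \<phi> 0 w)" for i using lets_lift[of e i x \<phi> 0 w] w by blast
    have "eqr (range (\<lambda>k. shift k r')) (lift x \<phi> 0 w) []"
      by (rule lift_eqr_shift[OF eq \<phi>(2) r'(1) conjw_refl])
    from window_embed(2)[OF r'(2) IH[OF len] mM _ this, of 0] no have "eqr {} (lift x \<phi> 0 w) []" by blast
    then show ?thesis using fin \<phi> by blast
  next
    case (3 x)
    have only: "y \<in> {e, x}" if "y \<in> lets r" for y
      using 3(3) 3(4)[OF that] by blast
    \<comment> \<open>Here e itself is collapsed, and the windows refer to the lifts of x.\<close>
    let ?f = "ind e"
    have \<phi>: "?f e > 0" "wt ?f r = 0" using 3(2,3) by (simp, metis)
    obtain r' where r': "conjw {} (lift e ?f 0 r) r'" "cycmin r'" "length r' \<le> length (lift e ?f 0 r)"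
      using cycmin_exists by blast
    have len: "length (shift k r') < length r" for k
      using r'(3) length_lift_less[OF er, of ?f 0] by simp
    have conj_r: "conjw {} r (sub (unlift e ?f) r')" using unlift_conj[where \<phi> = ?f, OF \<phi> r'(1), of 0] by simp
    have lr': "y = x" if "(y, i) \<in> lets r'" for y i
    proof -
      have "(y, i) \<in> lets (lift e ?f 0 r)" using cycmin_lets[OF r'(2) conjw_sym[OF r'(1)]] that by blast
      then show ?thesis using lets_lift[of y i e ?f 0 r] only[of y] by blast
    qed
    have "r' \<noteq> []" using conj_e[OF conj_r] by auto
    then obtain i where "(x, i) \<in> lets r'" using lr' by (cases r') (auto, metis fst_conv surj_pair)
    then obtain m M where mM: "(x, m) \<in> lets r'" "(x, M) \<in> lets r'"
      "\<And>i. (x, i) \<in> lets r' \<Longrightarrow> m \<le> i \<and> i \<le> M" by (rule height_bounds) blast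
    \<comment> \<open>If r' stayed at one height, r would be conjugate to a word in x alone,
      although e is essential.\<close>
    have "m \<noteq> M"
    proof
      assume "m = M"
      then have l: "i = m \<and> y = x" if "(y, i) \<in> lets r'" for y i
        using lr'[OF that] mM(3)[of i] that by auto
      let ?t = "mapw fst r'"
      have "lift e ?f m ?t = r'" using l 3(2) by (intro lift_mapw_fst) auto
      moreover have lt: "lets ?t \<subseteq> {x}" using l by (simp del: image_iff) (metis image_subsetI prod.collapse singletonI)
      then have "e \<notin> lets ?t" using 3(2) by blast
      then have "wt ?f ?t = 0" by (rule wt_ind_notin)
      ultimately have "conjw {} (sub (unlift e ?f) r') ?t"
        using unlift_lift_conj[where \<phi> = ?f, OF \<phi>(1), of ?t "{}" m] by simp
      with conj_r have "e \<in> lets ?t" by (blast intro: conj_e conjw_trans)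
      then show False using \<open>e \<notin> lets ?t\<close> by blast
    qed
    then have mM': "m < M" using mM(3)[OF mM(1)] by linarith
    have h: "i = 0" if "(x, i) \<in> lets (lift e ?f 0 w)" for i
      by (rule lets_lift_height[OF _ that]) (use w in \<open>auto simp: ind_def\<close>)
    have "eqr (range (\<lambda>k. shift k r')) (lift e ?f 0 w) []"
      by (rule lift_eqr_shift[OF eq \<phi>(2) r'(1) conjw_refl])
    \<comment> \<open>Shifting by - m puts the window at heights 0 to M - m. The lifted word has x
      only at height 0 and misses the top, since m < M.\<close>
    from window_embed(2)[OF r'(2) IH[OF len] mM _ this, of "- m"] h mM'
    have "eqr {} (lift e ?f 0 w) []" by force
    then show ?thesis using fin \<phi> by blast
  qed
qed

lemma freiheit_nat: "freiheit (r :: nat word)"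
proof (induction r rule: length_induct)
  case (1 r)
  show ?case
  proof (rule freiheit_step)
    fix r' :: "(nat \<times> int) word" assume "length r' < length r"
    then show "freiheit r'" using 1 by (simp add: freiheit_inj[OF inj_to_nat])
  qed
qed

theorem freiheitssatz: "freiheit (r :: 'a :: countable word)"
  by (rule freiheit_inj[OF inj_to_nat freiheit_nat])

subsection \<open>Magnus' conjugacy theorem\<close>

text \<open>The exponents of r and s divide each other, so they agree up to sign. The further
  relators R make room for \<open>rel\<close> when windows of length zero are treated.\<close>

lemma magnus_cyclic:
  assumes rs: "eqr (insert r R) s []" and sr: "eqr (insert s R) r []"
    and R: "\<And>q. q \<in> R \<Longrightarrow> wt (ind x) q = 0" and l: "lets r \<subseteq> {x}" "lets s \<subseteq> {x}"
  shows "conjw {} s r \<or> conjw {} s (winv r)"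
proof -
  let ?w = "wt (ind x)"
  have "?w r dvd ?w s - ?w []" by (rule wt_eqr_dvd[OF rs]) (use R in auto)
  moreover have "?w s dvd ?w r - ?w []" by (rule wt_eqr_dvd[OF sr]) (use R in auto)
  ultimately have "\<bar>?w r\<bar> = \<bar>?w s\<bar>" by (intro zdvd_antisym_abs) simp_all
  then consider "?w s = ?w r" | "?w s = ?w (winv r)" by fastforce
  then show ?thesis
  proof cases
    case 1
    have "eqr {} s r"
      using eqr_pw_single[OF l(2), of "{}"] eqr_sym[OF eqr_pw_single[OF l(1), of "{}"]] 1
      by (auto intro: eqr_trans)
    then show ?thesis by (simp add: eqr_imp_conjw)
  next
    case 2
    have "lets (winv r) \<subseteq> {x}" using l(1) by simp
    then have "eqr {} s (winv r)"
      using eqr_pw_single[OF l(2), of "{}"] eqr_sym[OF eqr_pw_single[of "winv r" x "{}"]] 2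
      by (auto intro: eqr_trans)
    then show ?thesis by (simp add: eqr_imp_conjw)
  qed
qed

lemma eqr_triv_relator: "eqr {r} s [] \<Longrightarrow> eqr {} r [] \<Longrightarrow> eqr {} s []"
  by (erule eqr_change_relators) simp

text \<open>In the cover, the lifts of e must span equally many heights in r' and s', since
  otherwise one of the two words would be freely trivial. After alignment both words have the same
  normal closure in a free group, and r' is shorter than r, so the induction hypothesis
  applies.\<close>

lemma magnus_step_cycmin:
  fixes r :: "'a :: countable word"
  assumes IH: "\<And>r' :: ('a \<times> int) word. length r' < length r \<Longrightarrow> magnus r'"
    and cr: "cycmin r" and cs: "cycmin s" and rs: "eqr {r} s []" and sr: "eqr {s} r []"
  shows "conjw {} s r \<or> conjw {} s (winv r)"
proof (cases "eqr {} s []")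
  case True
  then have "eqr {} s r" using eqr_triv_relator[OF sr] by (blast intro: eqr_sym eqr_trans)
  then show ?thesis by (simp add: eqr_imp_conjw)
next
  case s: False
  then have r: "\<not> eqr {} r []" using eqr_triv_relator[OF rs] by blast
  \<comment> \<open>The Freiheitssatz forces r and s to involve the same letters.\<close>
  have e_s: "e \<in> lets s" if "e \<in> lets r" for e
    using freiheitD[OF freiheitssatz cycmin_essential[OF cr that] _ rs] s by blast
  have e_r: "e \<in> lets r" if "e \<in> lets s" for e
    using freiheitD[OF freiheitssatz cycmin_essential[OF cs that] _ sr] r by blast
  have "r \<noteq> []" using r by auto
  then obtain x where x: "x \<in> lets r" by (cases r) auto
  show ?thesis
  proof (cases "lets r \<subseteq> {x}")
    case True
    then show ?thesis using magnus_cyclic[of r "{}" s x] rs sr e_r by blast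
  next
    case False
    then obtain y where y: "y \<in> lets r" "y \<noteq> x" by blast
    let ?good = "\<lambda>x. wt (ind x) r = 0 \<or> (\<exists>t. t \<noteq> x \<and> wt (ind t) r \<noteq> 0)"
    \<comment> \<open>If x alone has nonzero exponent sum, then y qualifies in its place, having
      exponent sum zero.\<close>
    have "\<exists>x e. x \<in> lets r \<and> e \<in> lets r \<and> e \<noteq> x \<and> ?good x" using x y by metis
    then obtain x e where x: "x \<in> lets r" and e: "e \<in> lets r" "e \<noteq> x" and good: "?good x"
      by blast
    obtain \<phi> where \<phi>: "\<phi> x > 0" "wt \<phi> r = 0" using choose_weight[OF good] by blast
    have \<phi>s: "wt \<phi> s = 0" using wt_eqr[OF rs, of \<phi>] \<phi>(2) by simp
    obtain r' where r': "conjw {} (lift x \<phi> 0 r) r'" "cycmin r'" "length r' \<le> length (lift x \<phi> 0 r)"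
      using cycmin_exists by blast
    obtain s' where s': "conjw {} (lift x \<phi> 0 s) s'" "cycmin s'" using cycmin_exists by blast
    obtain i where "(e, i) \<in> lets r'"
      using lift_essential[where \<phi> = \<phi>, OF cycmin_essential[OF cr e(1)] \<phi> e(2) r'(1)] by blast
    then obtain m M where mM: "(e, m) \<in> lets r'" "(e, M) \<in> lets r'"
      "\<And>i. (e, i) \<in> lets r' \<Longrightarrow> m \<le> i \<and> i \<le> M" by (rule height_bounds) blast
    obtain i where "(e, i) \<in> lets s'"
      using lift_essential[where \<phi> = \<phi>, OF cycmin_essential[OF cs e_s[OF e(1)]] \<phi>(1) \<phi>s e(2) s'(1)] by blast
    then obtain n N where nN: "(e, n) \<in> lets s'" "(e, N) \<in> lets s'"
      "\<And>i. (e, i) \<in> lets s' \<Longrightarrow> n \<le> i \<and> i \<le> N" by (rule height_bounds) blast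
    have conj_r: "conjw {} (lift x \<phi> k r) (shift k r')" for k
      using conjw_shift[OF r'(1), of k] lift_eq_shift[of x \<phi> k r] by simp
    have s'_eq: "eqr (range (\<lambda>k. shift k r')) s' []" by (rule lift_eqr_shift[OF rs \<phi>(2) r'(1) s'(1)])
    have r'_eq: "eqr (range (\<lambda>k. shift k s')) (shift k r') []" for k
      by (rule lift_eqr_shift[OF sr \<phi>s s'(1) conj_r])
    have "\<not> eqr {} s' []" "\<not> eqr {} r' []"
      using cycmin_triv[OF s'(2)] cycmin_triv[OF r'(2)] nN(1) mM(1) by auto
    \<comment> \<open>If s' spans fewer heights than r', it fits into a window of r' and misses its
      top letter.\<close>
    moreover have "eqr {} s' []" if "N - n < M - m"
    proof (rule window_embed(2)[OF r'(2) freiheitssatz mM _ s'_eq])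
      show "m + (n - m) \<le> i \<and> i \<le> M + (n - m)" if "(e, i) \<in> lets s'" for i
        using nN(3)[OF that] \<open>N - n < M - m\<close> by simp
      show "(e, m + (n - m)) \<notin> lets s' \<or> (e, M + (n - m)) \<notin> lets s'"
        using nN(3)[of "M + (n - m)"] that by linarith
    qed
    moreover have "eqr {} r' []" if "M - m < N - n"
    proof (rule window_embed(2)[OF s'(2) freiheitssatz nN _ r'_eq[of 0, simplified]])
      show "n + (m - n) \<le> i \<and> i \<le> N + (m - n)" if "(e, i) \<in> lets r'" for i
        using mM(3)[OF that] \<open>M - m < N - n\<close> by simp
      show "(e, n + (m - n)) \<notin> lets r' \<or> (e, N + (m - n)) \<notin> lets r'"
        using mM(3)[of "N + (m - n)"] that by linarith
    qed
    ultimately have len: "N = M + (n - m)" by linarith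
    \<comment> \<open>The shift that makes the lowest lifts of e in r' and s' coincide.\<close>
    define k where "k = n - m"
    have "eqr {shift k r'} s' []"
      using window_embed(1)[OF r'(2) freiheitssatz mM _ s'_eq, of k] nN(3) len by (force simp: k_def)
    moreover have "eqr {s'} (shift k r') []"
      using window_embed(1)[OF s'(2) freiheitssatz nN _ r'_eq[of k], of 0] mM(3) len
      by (force simp: k_def lets_shift)
    moreover have "magnus (shift k r')"
      using r'(3) length_lift_less[OF x, of \<phi> 0] by (intro IH) simp
    ultimately have "conjw {} s' (shift k r') \<or> conjw {} s' (winv (shift k r'))" by (simp add: magnus_def)
    then have "conjw {} (sub (unlift x \<phi>) s') (sub (unlift x \<phi>) (shift k r')) \<or>
        conjw {} (sub (unlift x \<phi>) s') (winv (sub (unlift x \<phi>) (shift k r')))"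
      using conjw_sub[of "{}" s' "shift k r'" "{}" "unlift x \<phi>"]
        conjw_sub[of "{}" s' "winv (shift k r')" "{}" "unlift x \<phi>"] by auto
    moreover have "conjw {} s (sub (unlift x \<phi>) s')"
      using unlift_conj[where \<phi> = \<phi>, OF \<phi>(1) \<phi>s s'(1), of 0] by simp
    moreover have "conjw {} (sub (unlift x \<phi>) (shift k r')) r"
      by (rule conjw_sym[OF unlift_conj[where \<phi> = \<phi>, OF \<phi> r'(1)]])
    ultimately show ?thesis by (blast intro: conjw_trans conjw_winv)
  qed
qed

lemma magnus_step:
  fixes r :: "'a :: countable word"
  assumes IH: "\<And>r' :: ('a \<times> int) word. length r' < length r \<Longrightarrow> magnus r'"
  shows "magnus r"
  unfolding magnus_def
proof (intro allI impI)
  fix s assume rs: "eqr {r} s []" and sr: "eqr {s} r []"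
  obtain r' where r': "conjw {} r r'" "cycmin r'" "length r' \<le> length r" using cycmin_exists by blast
  obtain s' where s': "conjw {} s s'" "cycmin s'" using cycmin_exists by blast
  have "conjw {} s' r' \<or> conjw {} s' (winv r')"
    using r' s' eqr_conj_both[OF rs r'(1) s'(1)] eqr_conj_both[OF sr s'(1) r'(1)]
    by (intro magnus_step_cycmin IH) auto
  then show "conjw {} s r \<or> conjw {} s (winv r)"
    using r'(1) s'(1) by (metis conjw_sym conjw_trans conjw_winv)
qed

lemma magnus_nat: "magnus (r :: nat word)"
proof (induction r rule: length_induct)
  case (1 r)
  show ?case
  proof (rule magnus_step)
    fix r' :: "(nat \<times> int) word" assume "length r' < length r"
    then show "magnus r'" using 1 by (simp add: magnus_inj[OF inj_to_nat])
  qed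
qed

theorem magnus_conjugacy: "magnus (r :: 'a :: countable word)"
  by (rule magnus_inj[OF inj_to_nat magnus_nat])

subsection \<open>The kernel of the exponent sum in b\<close>

instance gen :: countable
  by countable_datatype

locale commutator_relator =
  fixes c :: "gen word"
  assumes c: "lets c \<subseteq> range GY"
begin

abbreviation "rel \<equiv> comm_ab @ c"

abbreviation "lft \<equiv> lift GB (ind GB)"
abbreviation "ulft \<equiv> sub (unlift GB (ind GB))"

definition rho :: "int \<Rightarrow> (gen \<times> int) word" where
  "rho h = lft h rel"

text \<open>The lower end is included for \<open>GA\<close> and excluded for \<open>GY\<close>,
  because the relations between a_i, ..., a_(i+n) involve the lifts of c at heights i + 1 to i + n.
  Neighbouring windows of positive length then overlap in a window, and \<open>win i 0\<close>
  contains a_i alone.\<close>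

definition win :: "int \<Rightarrow> nat \<Rightarrow> (gen \<times> int) set" where
  "win i n = {p. fst p = GA \<and> i \<le> snd p \<and> snd p \<le> i + int n \<or>
                 fst p \<in> range GY \<and> i < snd p \<and> snd p \<le> i + int n}"

definition win_rel :: "int \<Rightarrow> nat \<Rightarrow> (gen \<times> int) word set" where
  "win_rel i n = rho ` {i<..i + int n}"

lemma lets_c: "z \<in> lets c \<Longrightarrow> z \<in> range GY"
  using c by blast

lemma wt_c: "x \<notin> range GY \<Longrightarrow> wt (ind x) c = 0"
  by (rule wt_ind_notin) (use c in blast)

lemma wt_rel [simp]: "wt (ind GB) comm_ab = 0" "wt (ind GA) comm_ab = 0"
    "wt (ind GB) c = 0" "wt (ind GA) c = 0"
  using wt_c[of GA] wt_c[of GB] by (auto simp: comm_ab_def)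

lemma lets_lift_c:
  assumes "p \<in> lets (lft h c)" shows "fst p \<in> range GY" "snd p = h"
proof -
  have p: "(fst p, snd p) \<in> lets (lft h c)" using assms by simp
  from lets_lift[OF p] show "fst p \<in> range GY" using lets_c by blast
  show "snd p = h" by (rule lets_lift_height[OF _ p]) (use lets_c in fastforce)
qed

lemma lets_lift_c_win: "i < h \<Longrightarrow> h \<le> i + int n \<Longrightarrow> lets (lft h c) \<subseteq> win i n"
  using lets_lift_c by (intro subsetI) (simp add: win_def del: image_iff)

text \<open>The letters b of the commutator are collapsed and only move the path between the heights
  h and h - 1, so \<open>rho h\<close> expresses a_h = a_(h-1) c_h.\<close>

lemma rho_eq: "rho h = [((GA, h), True), ((GA, h - 1), False)] @ lft h c"
  by (simp add: rho_def comm_ab_def lift_append)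

lemma shift_rho: "shift k (rho h) = rho (h + k)"
  by (simp add: rho_def lift_shift)

lemma shift_range_rho: "shift k ` range rho = range rho"
proof -
  have "rho h \<in> shift k ` range rho" for h
    using shift_rho[of k "h - k"] by (intro image_eqI[of _ _ "rho (h - k)"]) auto
  then show ?thesis by (auto simp: shift_rho)
qed

lemma conjw_rho_shift: "conjw (range rho) v w \<Longrightarrow> conjw (range rho) (shift k v) (shift k w)"
  using conjw_mapw[of "range rho" v w "\<lambda>p. (fst p, snd p + k)"] shift_range_rho[of k]
  by (simp add: shift_def)

lemma lets_shift_win:
  assumes "lets t \<subseteq> win i n" shows "lets (shift k t) \<subseteq> win (i + k) n"
proof
  fix p assume "p \<in> lets (shift k t)"
  then have "(fst p, snd p - k) \<in> lets t" using lets_shift[of "fst p" "snd p" k t] by simp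
  then have "(fst p, snd p - k) \<in> win i n" using assms by blast
  then show "p \<in> win (i + k) n" by (auto simp: win_def)
qed

lemma ulft_rho: "conjw {} (ulft (rho h)) rel"
  unfolding rho_def by (rule unlift_lift_conj) simp_all

lemma conjw_ulft: "conjw (range rho) v w \<Longrightarrow> conjw {rel} (ulft v) (ulft w)"
proof (erule conjw_sub)
  fix r assume "r \<in> range rho"
  then obtain h where "r = rho h" by blast
  then show "eqr {rel} (ulft r) []"
    using conjw_triv[OF conjw_free[OF ulft_rho[of h]]] by (simp add: eqr_rel)
qed

text \<open>In the cover, \<open>(GA, j)\<close> equals \<open>(GA, j - 1)\<close> times the lift of c, so that every
  \<open>(GA, j)\<close> can be expressed by \<open>(GA, p)\<close> and letters over the generators GY.\<close>

fun up :: "int \<Rightarrow> nat \<Rightarrow> (gen \<times> int) word" where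
  "up p 0 = [((GA, p), False)]"
| "up p (Suc n) = up p n @ lft (p + 1 + int n) c"

fun down :: "int \<Rightarrow> nat \<Rightarrow> (gen \<times> int) word" where
  "down p 0 = [((GA, p), False)]"
| "down p (Suc n) = down p n @ winv (lft (p - int n) c)"

definition chain :: "int \<Rightarrow> int \<Rightarrow> (gen \<times> int) word" where
  "chain p j = (if p \<le> j then up p (nat (j - p)) else down p (nat (p - j)))"

text \<open>Eliminates every a_j in favour of a_p. This kills all \<open>rho\<close> and changes
  words only by consequences of them, so it identifies the group given by \<open>rho\<close> with a
  free group.\<close>

definition elim :: "int \<Rightarrow> gen \<times> int \<Rightarrow> (gen \<times> int) word" where
  "elim p q = (if fst q = GA then chain p (snd q) else [(q, False)])"

lemma chain_self: "chain p p = [((GA, p), False)]"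
  by (simp add: chain_def)

lemma chain_up: "p < j \<Longrightarrow> chain p j = chain p (j - 1) @ lft j c"
proof -
  assume "p < j"
  then have "nat (j - p) = Suc (nat (j - 1 - p))" by simp
  then show ?thesis using \<open>p < j\<close> by (simp add: chain_def)
qed

lemma chain_down: "j \<le> p \<Longrightarrow> chain p (j - 1) = chain p j @ winv (lft j c)"
proof -
  assume "j \<le> p"
  then have "nat (p - (j - 1)) = Suc (nat (p - j))" by simp
  then show ?thesis using \<open>j \<le> p\<close> by (cases "j = p") (simp_all add: chain_def)
qed

lemma chain_step: "eqr R (chain p j) (chain p (j - 1) @ lft j c)"
proof (cases "p < j")
  case False
  then show ?thesis
    using chain_down[of j p] eqr_sym[OF eqr_cancel_words(2)[of R "chain p j" "lft j c" "[]"]] by simp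
qed (simp add: chain_up)

lemma lets_chain:
  assumes "i \<le> p" "p \<le> i + int n" "i \<le> j" "j \<le> i + int n" shows "lets (chain p j) \<subseteq> win i n"
proof -
  have "lets (up p m) \<subseteq> win i n" if "p + int m \<le> i + int n" for m
    using that
  proof (induction m)
    case 0
    then show ?case using assms by (simp add: win_def)
  next
    case (Suc m)
    then show ?case using lets_lift_c_win[of i "p + 1 + int m" n] assms(1) by (simp add: image_Un)
  qed
  moreover have "lets (down p m) \<subseteq> win i n" if "i \<le> p - int m" for m
    using that
  proof (induction m)
    case 0
    then show ?case using assms by (simp add: win_def)
  next
    case (Suc m)
    then show ?case using lets_lift_c_win[of i "p - int m" n] assms(2) by (simp add: image_Un)
  qed
  ultimately show ?thesis using assms by (simp add: chain_def)
qed

text \<open>The chain from p to j uses lifts of c only at heights between the two, so elimination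
  does not leave a window that contains a_p.\<close>

lemma lets_sub_elim:
  assumes "lets w \<subseteq> win i n" "i \<le> p" "p \<le> i + int n" shows "lets (sub (elim p) w) \<subseteq> win i n"
proof -
  have "lets (elim p q) \<subseteq> win i n" if "q \<in> lets w" for q
  proof (cases "fst q = GA")
    case True
    moreover have "q \<in> win i n" using that assms(1) by blast
    ultimately have "i \<le> snd q" "snd q \<le> i + int n" by (auto simp: win_def)
    from lets_chain[OF assms(2,3) this] True show ?thesis by (simp add: elim_def)
  next
    case False
    then show ?thesis using that assms(1) by (auto simp: elim_def simp del: image_iff)
  qed
  then show ?thesis unfolding lets_sub by blast
qed

lemma sub_elim_c: "sub (elim p) (lft h c) = lft h c"
proof -
  have "sub (elim p) w = w" if "\<And>q. q \<in> lets w \<Longrightarrow> fst q \<noteq> GA" for w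
    using that
  proof (induction w)
    case (Cons l w)
    obtain q b where l: "l = (q, b)" by (cases l)
    have "fst q \<noteq> GA" by (rule Cons.prems) (simp add: l)
    moreover have "sub (elim p) w = w" by (rule Cons.IH, rule Cons.prems) simp
    moreover have "elim p q = [(q, False)]" using \<open>fst q \<noteq> GA\<close> by (simp add: elim_def)
    ultimately show ?case by (simp add: l)
  qed simp
  moreover have "fst q \<noteq> GA" if "q \<in> lets (lft h c)" for q using lets_lift_c(1)[OF that] by auto
  ultimately show ?thesis by simp
qed

lemma sub_elim_rho: "eqr R (sub (elim p) (rho h)) []"
  using eqr_winv_append[of R "chain p h" "chain p (h - 1) @ lft h c"] chain_step[of R p h]
  by (simp add: rho_eq sub_elim_c) (simp add: elim_def)

lemma eqr_rho_step: "rho j \<in> R \<Longrightarrow> eqr R [((GA, j), False)] ([((GA, j - 1), False)] @ lft j c)"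
  using eqr_rel[of "rho j" R] eqr_winv_append[of R "[((GA, j), False)]" "[((GA, j - 1), False)] @ lft j c"]
  by (simp add: rho_eq)

lemma eqr_chain:
  "(\<And>k. min p j < k \<Longrightarrow> k \<le> max p j \<Longrightarrow> rho k \<in> R) \<Longrightarrow> eqr R [((GA, j), False)] (chain p j)"
proof (induction j rule: int_induct[of _ p])
  case base
  show ?case by (simp add: chain_self)
next
  case (step1 j)
  have "eqr R [((GA, j + 1), False)] ([((GA, j), False)] @ lft (j + 1) c)"
    using eqr_rho_step[of "j + 1" R] step1 by simp
  also have "eqr R \<dots> (chain p j @ lft (j + 1) c)"
    using step1 by (intro eqr_append eqr_refl step1.IH) auto
  finally show ?case using chain_up[of p "j + 1"] step1(1) by simp
next
  case (step2 j)
  have "eqr R ([((GA, j - 1), False)] @ lft j c @ winv (lft j c)) ([((GA, j), False)] @ winv (lft j c))"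
    using eqr_append[OF eqr_sym[OF eqr_rho_step[of j R]], of "winv (lft j c)"] step2 by simp
  also have "eqr R \<dots> (chain p j @ winv (lft j c))"
    using step2 by (intro eqr_append eqr_refl step2.IH) auto
  finally show ?case
    using chain_down[of j p] step2(1) eqr_cancel_words(1)[of R "[((GA, j - 1), False)]" "lft j c" "[]"]
    by (auto intro: eqr_trans eqr_sym)
qed

lemma eqr_elim: "range rho \<subseteq> R \<Longrightarrow> eqr R w (sub (elim p) w)"
proof -
  assume "range rho \<subseteq> R"
  then have "eqr R [(q, False)] (elim p q)" for q
    using eqr_chain[of p "snd q" R] by (cases q) (auto simp: elim_def)
  then show ?thesis using sub_cong[where w = w and f = "\<lambda>x. [(x, False)]" and g = "elim p"] by simp
qed

lemma eqr_elim_win: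
  assumes "lets w \<subseteq> win i n" "i \<le> p" "p \<le> i + int n" shows "eqr (win_rel i n) w (sub (elim p) w)"
proof -
  have "eqr (win_rel i n) [(q, False)] (elim p q)" if "q \<in> lets w" for q
  proof (cases "fst q = GA")
    case True
    moreover have "q \<in> win i n" using that assms(1) by blast
    ultimately have "i \<le> snd q" "snd q \<le> i + int n" by (auto simp: win_def)
    then have "eqr (win_rel i n) [((GA, snd q), False)] (chain p (snd q))"
      using assms(2,3) unfolding win_rel_def by (intro eqr_chain imageI) (auto simp: min_def max_def split: if_splits)
    then show ?thesis using True by (cases q) (simp add: elim_def)
  qed (simp add: elim_def)
  then show ?thesis using sub_cong[of w "win_rel i n" "\<lambda>x. [(x, False)]" "elim p"] by simp
qed

section \<open>Minimal windows\<close>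

lemma win_mono: "m \<le> n \<Longrightarrow> win i m \<subseteq> win i n"
  by (auto simp: win_def)

text \<open>The Freiheitssatz for windows. Eliminating in favour of a_i makes the group free and the
  window a free factor. As no conjugate of t lies in the window, the cyclically minimal form of t
  has a letter outside it, which the image of w avoids.\<close>

lemma freiheit_win:
  assumes t: "\<And>t'. conjw (range rho) t t' \<Longrightarrow> \<not> lets t' \<subseteq> win i m"
    and w: "lets w \<subseteq> win i m" and eq: "eqr (insert t (range rho)) w []"
  shows "eqr (win_rel i m) w []"
proof -
  obtain t' where t': "conjw {} (sub (elim i) t) t'" "cycmin t'" using cycmin_exists by blast
  have "conjw (range rho) t t'"
    using eqr_imp_conjw[OF eqr_elim[OF order_refl, of t i]] conjw_free[OF t'(1)] by (rule conjw_trans)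
  then obtain e where e: "e \<in> lets t'" "e \<notin> win i m" using t by blast
  have "eqr {t'} (sub (elim i) w) (sub (elim i) [])"
  proof (rule eqr_sub[OF eq])
    fix r assume "r \<in> insert t (range rho)"
    then show "eqr {t'} (sub (elim i) r) []"
      using sub_elim_rho conjw_triv[OF conjw_free[OF t'(1)] eqr_rel] by auto
  qed
  moreover have "e \<notin> lets (sub (elim i) w)" using lets_sub_elim[OF w, of i] e(2) by fastforce
  ultimately have "eqr {} (sub (elim i) w) []"
    using freiheitD[OF freiheitssatz cycmin_essential[OF t'(2) e(1)]] by simp
  then show ?thesis
    using eqr_elim_win[OF w, of i] eqr_free[of "sub (elim i) w" "[]" "win_rel i m"] by (auto intro: eqr_trans)
qed

text \<open>All conjugates of all shifts of t compete, so n depends only on the conjugacy class up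
  to shift; a shift also allows the window to start at 0.\<close>

definition minimal_win :: "(gen \<times> int) word \<Rightarrow> nat \<Rightarrow> bool" where
  "minimal_win t n \<longleftrightarrow> lets t \<subseteq> win 0 n \<and>
     (\<forall>k i m t'. conjw (range rho) (shift k t) t' \<longrightarrow> lets t' \<subseteq> win i m \<longrightarrow> n \<le> m)"

lemma minimal_winD:
  "minimal_win t n \<Longrightarrow> conjw (range rho) (shift k t) t' \<Longrightarrow> lets t' \<subseteq> win i m \<Longrightarrow> n \<le> m"
  by (simp add: minimal_win_def)

lemma minimal_win_exists: "\<exists>t n j. minimal_win t n \<and> conjw (range rho) (lft j r) t"
proof -
  let ?fits = "\<lambda>n. \<exists>i t. lets t \<subseteq> win i n \<and> conjw (range rho) (lft 0 r) t"
  define N where "N = Max (insert 0 ((\<lambda>p. \<bar>snd p\<bar>) ` lets (lft 0 r)))"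
  have N: "\<bar>snd p\<bar> \<le> N" if "p \<in> lets (lft 0 r)" for p
    unfolding N_def using that by (intro Max_ge) auto
  \<comment> \<open>The lower end is - N - 1 because a window excludes the letters over
    \<open>GY\<close> at its lower end.\<close>
  have "p \<in> win (- N - 1) (nat (2 * N + 1))" if p: "p \<in> lets (lft 0 r)" for p
  proof -
    have "(fst p, snd p) \<in> lets (lft 0 r)" using p by simp
    from lets_lift[OF this] have "fst p \<noteq> GB" by blast
    then have "fst p = GA \<or> fst p \<in> range GY" by (cases "fst p") auto
    moreover have "- N - 1 + int (nat (2 * N + 1)) = N" using N[OF p] by simp
    ultimately show ?thesis using N[OF p] unfolding win_def by auto
  qed
  then have "?fits (nat (2 * N + 1))" by (blast intro: conjw_refl)
  then have fits: "?fits (LEAST n. ?fits n)" by (rule LeastI)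
  define n where "n = (LEAST n. ?fits n)"
  obtain i t where t: "lets t \<subseteq> win i n" "conjw (range rho) (lft 0 r) t" using fits unfolding n_def by blast
  have conj: "conjw (range rho) (lft k r) (shift k t)" for k
    using conjw_rho_shift[OF t(2), of k] lift_eq_shift[of GB "ind GB" k r] by simp
  have "minimal_win (shift (- i) t) n" unfolding minimal_win_def
  proof (intro conjI allI impI)
    show "lets (shift (- i) t) \<subseteq> win 0 n" using lets_shift_win[OF t(1), of "- i"] by simp
    fix k j m t' assume t': "conjw (range rho) (shift k (shift (- i) t)) t'" "lets t' \<subseteq> win j m"
    \<comment> \<open>Undoing both shifts turns a window for a shift of t into one for the original
      lift.\<close>
    have "conjw (range rho) (shift (i - k) (shift k (shift (- i) t))) (shift (i - k) t')"
      by (rule conjw_rho_shift[OF t'(1)])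
    then have "conjw (range rho) (lft 0 r) (shift (i - k) t')" using conjw_trans[OF t(2)] by simp
    then have "?fits m" using lets_shift_win[OF t'(2)] by blast
    then show "n \<le> m" unfolding n_def by (rule Least_le)
  qed
  with conj[of "- i"] show ?thesis by blast
qed

lemma win_cap: "win k (Suc n) \<inter> win (k + 1) (Suc n) = win (k + 1) n"
  by (auto simp: win_def)

lemma win_rel_subset: "win_rel i n \<subseteq> range rho"
  by (auto simp: win_rel_def)

text \<open>Neighbouring windows of length n + 1 overlap in a window of length n. By minimality no
  conjugate of t fits there, so on the overlap \<open>freiheit_win\<close> leaves only the relators
  \<open>win_rel\<close> from either side, and \<open>stagger\<close> applies.\<close>

lemma cover_embed:
  assumes t: "minimal_win t (Suc n)" and w: "lets w \<subseteq> win 0 (Suc n)"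
    and eq: "eqr (range rho \<union> range (\<lambda>k. shift k t)) w []"
  shows "eqr (insert t (win_rel 0 (Suc n))) w []"
proof -
  let ?R = "\<lambda>k. insert (shift k t) (win_rel k (Suc n))"
  have free: "eqr (win_rel (k + 1) n) v []"
    if "eqr (insert (shift k' t) (range rho)) v []" "lets v \<subseteq> win (k + 1) n" for k k' v
    by (rule freiheit_win[OF _ that(2,1)]) (use t in \<open>fastforce simp: minimal_win_def\<close>)
  have "eqr (?R 0) w []"
  proof (rule stagger[where S = "\<lambda>k. win k (Suc n)" and R = ?R, OF _ _ _ w])
    fix i r assume "r \<in> ?R i"
    then consider "r = shift i t" | h where "r = rho h" "i < h" "h \<le> i + int (Suc n)"
      by (auto simp: win_rel_def)
    then show "lets r \<subseteq> win i (Suc n)"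
    proof cases
      case 1
      then show ?thesis using t lets_shift_win[of t 0 "Suc n" i] by (simp add: minimal_win_def)
    next
      case 2
      then have "(GA, h) \<in> win i (Suc n)" "(GA, h - 1) \<in> win i (Suc n)" by (auto simp: win_def)
      then show ?thesis using 2 lets_lift_c_win[of i h "Suc n"] by (simp add: rho_eq)
    qed
  next
    fix i j k :: int assume "i \<le> k" "k \<le> j"
    then show "win i (Suc n) \<inter> win j (Suc n) \<subseteq> win k (Suc n)" by (auto simp: win_def)
  next
    fix k
    have sub: "win_rel (k + 1) n \<subseteq> ?R k" "win_rel (k + 1) n \<subseteq> ?R (k + 1)"
      by (auto simp: win_rel_def)
    have "eqr (?R k') v [] \<longleftrightarrow> eqr (win_rel (k + 1) n) v []"
      if v: "lets v \<subseteq> win (k + 1) n" and k': "win_rel (k + 1) n \<subseteq> ?R k'" for k' v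
    proof
      assume "eqr (?R k') v []"
      then have "eqr (insert (shift k' t) (range rho)) v []"
        by (rule eqr_mono) (use win_rel_subset in blast)
      then show "eqr (win_rel (k + 1) n) v []" using v by (rule free)
    next
      assume "eqr (win_rel (k + 1) n) v []"
      then show "eqr (?R k') v []" using k' by (rule eqr_mono)
    qed
    then show "agree_on (win k (Suc n) \<inter> win (k + 1) (Suc n)) (?R k) (?R (k + 1))"
      unfolding agree_on_def win_cap using sub by (metis (no_types, lifting))
  next
    have "rho h \<in> ?R (h - 1)" for h by (auto simp: win_rel_def)
    then have "range rho \<union> range (\<lambda>k. shift k t) \<subseteq> (\<Union>k. ?R k)" by blast
    then show "eqr (\<Union>k. ?R k) w []" by (rule eqr_mono[OF eq])
  qed
  then show ?thesis by simp
qed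

text \<open>Every lift of r is a shift of the lift at height j, and shifts permute the relators
  \<open>rho\<close>. So a consequence of \<open>rel\<close> and r lifts to a consequence of
  \<open>rho\<close> and the shifts of t.\<close>

lemma cover_eqr:
  assumes eq: "eqr {rel, r} s []" and wt: "wt (ind GB) r = 0"
    and t: "conjw (range rho) (lft j r) t" and t': "conjw (range rho) (lft h s) t'"
  shows "eqr (range rho \<union> range (\<lambda>k. shift k t)) t' []"
proof -
  let ?R = "range rho \<union> range (\<lambda>k. shift k t)"
  have "eqr (\<Union>q\<in>{rel, r}. range (\<lambda>k. lft k q)) (lft h s) (lft h [])"
    by (rule lift_eqr[OF eq]) (use wt in auto)
  then have "eqr ?R (lft h s) (lft h [])"
  proof (rule eqr_change_relators)
    fix q assume "q \<in> (\<Union>q\<in>{rel, r}. range (\<lambda>k. lft k q))"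
    then consider k where "q = rho k" | k where "q = lft k r" by (auto simp: rho_def)
    then show "eqr ?R q []"
    proof cases
      case 1
      then show ?thesis by (simp add: eqr_rel)
    next
      case 2
      then have "q = shift (k - j) (lft j r)" using lift_shift[of GB "ind GB" j "k - j" r] by simp
      then have "conjw (range rho) q (shift (k - j) t)" using conjw_rho_shift[OF t] by simp
      then have "conjw ?R q (shift (k - j) t)" by (rule conjw_mono) blast
      then show ?thesis by (rule conjw_triv) (simp add: eqr_rel)
    qed
  qed
  then show ?thesis using conjw_triv[OF conjw_mono[OF conjw_sym[OF t']], of ?R] by simp
qed

lemma conj_zero_exponent:
  assumes rs: "eqr {rel, r} s []" and sr: "eqr {rel, s} r []" and wt: "wt (ind GB) r = 0"
  shows "conjw {rel} s r \<or> conjw {rel} s (winv r)"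
proof (cases "eqr {rel} s []")
  case True
  have "eqr {rel} r []" by (rule eqr_change_relators[OF sr]) (use True in \<open>auto intro: eqr_rel\<close>)
  then have "eqr {rel} s r" using True by (blast intro: eqr_sym eqr_trans)
  then show ?thesis by (simp add: eqr_imp_conjw)
next
  case False
  then have r: "\<not> eqr {rel} r []"
    using eqr_change_relators[OF rs, of "{rel}"] by (auto intro: eqr_rel)
  have "wt (ind GB) s = wt (ind GB) []" by (rule wt_eqr[OF rs]) (use wt in auto)
  then have wts: "wt (ind GB) s = 0" by simp
  obtain t n j where t: "minimal_win t n" "conjw (range rho) (lft j r) t" using minimal_win_exists by blast
  obtain t' n' j' where t': "minimal_win t' n'" "conjw (range rho) (lft j' s) t'"
    using minimal_win_exists by blast
  have ur: "conjw {rel} r (ulft t)" 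
    using conjw_trans[OF conjw_sym[OF unlift_lift_conj] conjw_ulft[OF t(2)]] wt by simp
  have us: "conjw {rel} s (ulft t')" 
    using conjw_trans[OF conjw_sym[OF unlift_lift_conj] conjw_ulft[OF t'(2)]] wts by simp
  have nt: "\<not> eqr (range rho) t []" "\<not> eqr (range rho) t' []"
    using conjw_triv[OF ur] conjw_triv[OF us] r False conjw_ulft[OF eqr_imp_conjw, of _ "[]"]
      conjw_triv[of "{rel}" _ "[]"] by (metis eqr_refl sub_simps(1))+
  have e: "eqr (range rho \<union> range (\<lambda>k. shift k t)) t' []" by (rule cover_eqr[OF rs wt t(2) t'(2)])
  have e': "eqr (range rho \<union> range (\<lambda>k. shift k t')) t []" by (rule cover_eqr[OF sr wts t'(2) t(2)])
  \<comment> \<open>If n' were smaller than n, then t' would lie in a window too short for any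
    conjugate of t, and \<open>freiheit_win\<close> would make t' trivial modulo
    \<open>rho\<close>.\<close>
  have le: "n \<le> n'" if t: "minimal_win t n" and t': "minimal_win t' n'"
    and e: "eqr (range rho \<union> range (\<lambda>k. shift k t)) t' []" and nt: "\<not> eqr (range rho) t' []" for t t' n n'
  proof (rule ccontr)
    assume "\<not> n \<le> n'"
    then obtain m where m: "n = Suc m" "n' \<le> m" by (cases n) auto
    have w: "lets t' \<subseteq> win 0 m" using t' win_mono[OF m(2), of 0] unfolding minimal_win_def by (meson subset_trans)
    then have "lets t' \<subseteq> win 0 (Suc m)" using win_mono[of m "Suc m" 0] by (meson le_SucI order_refl subset_trans)
    from cover_embed[OF t[unfolded m(1)] this e]
    have "eqr (insert t (range rho)) t' []" by (rule eqr_mono) (use win_rel_subset in blast)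
    then have "eqr (win_rel 0 m) t' []"
      using minimal_winD[OF t, of 0] m w by (intro freiheit_win[of t]) (fastforce, simp_all)
    then have "eqr (range rho) t' []" by (rule eqr_mono) (rule win_rel_subset)
    with nt show False ..
  qed
  have n': "n' = n" using le[OF t(1) t'(1) e nt(2)] le[OF t'(1) t(1) e' nt(1)] by simp
  have "conjw {rel} (ulft t') (ulft t) \<or> conjw {rel} (ulft t') (winv (ulft t))"
  proof (cases n)
    \<comment> \<open>Only the letter a_0 is left, so both elements become powers of a; as
      \<open>rel\<close> has exponent sum zero in a, their exponents can be compared.\<close>
    case 0
    have l: "lets (ulft w) \<subseteq> {GA}" if "lets w \<subseteq> win 0 0" for w
    proof -
      have "lets (unlift GB (ind GB) q) \<subseteq> {GA}" if "q \<in> lets w" for q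
        using that \<open>lets w \<subseteq> win 0 0\<close> by (cases q) (auto simp: win_def unlift_def simp del: image_iff)
      then show ?thesis unfolding lets_sub by blast
    qed
    have c: "eqr {ulft b, rel} (ulft a) []"
      if "eqr {rel, r'} s' []" "conjw {rel} r' (ulft b)" "conjw {rel} s' (ulft a)" for r' s' a b
    proof -
      have "eqr {ulft b, rel} s' []"
      proof (rule eqr_change_relators[OF that(1)])
        fix q assume "q \<in> {rel, r'}"
        then show "eqr {ulft b, rel} q []"
          using conjw_triv[OF conjw_mono[OF that(2), of "{ulft b, rel}"]] by (auto intro: eqr_rel)
      qed
      then show ?thesis using conjw_triv[OF conjw_mono[OF conjw_sym[OF that(3)]]] by blast
    qed
    have "conjw {} (ulft t') (ulft t) \<or> conjw {} (ulft t') (winv (ulft t))"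
      using t(1) t'(1) n' 0
      by (intro magnus_cyclic[where x = GA, OF c[OF rs ur us] c[OF sr us ur]] l)
        (simp_all add: minimal_win_def)
    then show ?thesis by (blast intro: conjw_free)
  next
    case (Suc m)
    \<comment> \<open>Eliminating in favour of a_0 kills \<open>rho\<close>. The images of t and t'
      then have the same normal closure in a free group, where Magnus' theorem applies.\<close>
    have el: "eqr {sub (elim 0) b} (sub (elim 0) a) []" if "eqr (insert b (win_rel 0 n)) a []" for a b
    proof -
      have "eqr {sub (elim 0) b} (sub (elim 0) a) (sub (elim 0) [])"
        by (rule eqr_sub[OF that]) (auto simp: win_rel_def sub_elim_rho eqr_rel)
      then show ?thesis by simp
    qed
    have "eqr (insert t (win_rel 0 n)) t' []" "eqr (insert t' (win_rel 0 n)) t []"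
      using t(1) t'(1) e e' unfolding n' Suc by (auto intro!: cover_embed simp: minimal_win_def)
    from this[THEN el] have m: "conjw {} (sub (elim 0) t') (sub (elim 0) t) \<or>
        conjw {} (sub (elim 0) t') (sub (elim 0) (winv t))"
      using magnus_conjugacy[of "sub (elim 0) t"] by (simp add: magnus_def)
    have el: "conjw (range rho) w (sub (elim 0) w)" for w
      by (rule eqr_imp_conjw[OF eqr_elim[OF order_refl]])
    have "conjw (range rho) t' w" if "conjw {} (sub (elim 0) t') (sub (elim 0) w)" for w
      by (rule conjw_trans[OF conjw_trans[OF el conjw_free[OF that]] conjw_sym[OF el]])
    with m have "conjw (range rho) t' t \<or> conjw (range rho) t' (winv t)" by blast
    then show ?thesis using conjw_ulft[of t' t] conjw_ulft[of t' "winv t"] by auto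
  qed
  then show ?thesis using us conjw_sym[OF ur] by (blast intro: conjw_trans conjw_winv)
qed

end

subsection \<open>Reduction to exponent zero\<close>

definition nielsen :: "gen \<Rightarrow> gen \<Rightarrow> bool \<Rightarrow> gen \<Rightarrow> gen word" where
  "nielsen x y b z = (if z = x then [(y, b), (x, False)] else [(z, False)])"

lemma nielsen_inverse:
  assumes "x \<noteq> y" shows "eqr R (sub (nielsen x y (\<not> b)) (nielsen x y b z)) [(z, False)]"
  using assms eqr_cancel[of R "[]" "(y, b)" "[(x, False)]"] by (auto simp: nielsen_def)

lemma wt_nielsen:
  assumes "x \<noteq> y"
  shows "wt (ind x) (sub (nielsen x y b) w) = wt (ind x) w"
    and "wt (ind y) (sub (nielsen x y b) w) = wt (ind y) w + (if b then -1 else 1) * wt (ind x) w"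
proof -
  have "(\<lambda>z. wt (ind x) (nielsen x y b z)) = ind x"
    using assms by (auto simp: nielsen_def ind_def)
  then show "wt (ind x) (sub (nielsen x y b) w) = wt (ind x) w" by (simp add: wt_sub)
  have "(\<lambda>z. wt (ind y) (nielsen x y b z)) = (\<lambda>z. 1 * ind y z + (if b then -1 else 1) * ind x z)"
    using assms by (auto simp: nielsen_def ind_def)
  then show "wt (ind y) (sub (nielsen x y b) w) = wt (ind y) w + (if b then -1 else 1) * wt (ind x) w"
    unfolding wt_sub by (simp only: wt_add)
qed

context commutator_relator
begin

definition conj_prop :: "gen word \<Rightarrow> bool" where
  "conj_prop r \<longleftrightarrow> (\<forall>s. eqr {rel, r} s [] \<longrightarrow> eqr {rel, s} r [] \<longrightarrow>
     conjw {rel} s r \<or> conjw {rel} s (winv r))"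

text \<open>The substitution f induces an endomorphism of the group with left inverse g; the
  conclusion for the images under f is pulled back along g.\<close>

lemma conj_prop_sub:
  assumes f: "eqr {rel} (sub f rel) []" and g: "eqr {rel} (sub g rel) []"
    and gf: "\<And>x. eqr {rel} (sub g (f x)) [(x, False)]"
    and r: "conj_prop (sub f r)"
  shows "conj_prop r"
  unfolding conj_prop_def
proof (intro allI impI)
  fix s assume rs: "eqr {rel, r} s []" and sr: "eqr {rel, s} r []"
  have fe: "eqr {rel, sub f b} (sub f a) []" if "eqr {rel, b} a []" for a b
  proof -
    have "eqr {rel, sub f b} (sub f a) (sub f [])"
      using that
    proof (rule eqr_sub)
      fix q assume "q \<in> {rel, b}"
      then show "eqr {rel, sub f b} (sub f q) []"
        using eqr_mono[OF f, of "{rel, sub f b}"] eqr_rel by blast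
    qed
    then show ?thesis by simp
  qed
  have gfw: "eqr {rel} (sub g (sub f w)) w" for w
    using sub_cong[of w "{rel}" "\<lambda>x. sub g (f x)" "\<lambda>x. [(x, False)]"] gf by (simp add: sub_sub)
  have "conjw {rel} s w" if "conjw {rel} (sub f s) (sub f w)" for w
  proof -
    have "conjw {rel} (sub g (sub f s)) (sub g (sub f w))"
      using that by (rule conjw_sub) (use g in auto)
    then show ?thesis
      using eqr_imp_conjw[OF gfw[of w]] conjw_sym[OF eqr_imp_conjw[OF gfw[of s]]] conjw_trans by blast
  qed
  moreover have "conjw {rel} (sub f s) (sub f r) \<or> conjw {rel} (sub f s) (sub f (winv r))"
    using r fe[OF rs] fe[OF sr] by (simp add: conj_prop_def)
  ultimately show "conjw {rel} s r \<or> conjw {rel} s (winv r)" by blast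
qed

lemma sub_nielsen_c: "x \<notin> range GY \<Longrightarrow> sub (nielsen x y b) c = c"
proof -
  assume x: "x \<notin> range GY"
  have "sub (nielsen x y b) w = w" if "x \<notin> lets w" for w
    using that by (induction w) (auto simp: nielsen_def)
  then show ?thesis using x lets_c by blast
qed

text \<open>The substitutions fix c, and the substituted relator is the original one with a single
  cancelling pair inserted.\<close>

lemma nielsen_rel: "eqr {rel} (sub (nielsen GB GA b) rel) []" "eqr {rel} (sub (nielsen GA GB b) rel) []"
proof -
  have rel: "eqr {rel} (p @ [l, inv_letter l] @ q) []" if "p @ q = rel" for p q l
    using eqr_trans[OF eqr_cancel eqr_rel, of p q "{rel}" l] that by simp
  have c: "sub (nielsen GB GA b) c = c" "sub (nielsen GA GB b) c = c"
    by (rule sub_nielsen_c, auto)+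
  show "eqr {rel} (sub (nielsen GB GA b) rel) []"
    using rel[of "[(GA, True), (GB, True)]" "[(GA, False), (GB, False)] @ c" "(GA, True)"]
      rel[of "[(GA, True), (GB, True), (GA, False)]" "(GB, False) # c" "(GA, False)"] c
    by (cases b) (auto simp: comm_ab_def nielsen_def[of _ _ _ GA] nielsen_def[of _ _ _ GB])
  show "eqr {rel} (sub (nielsen GA GB b) rel) []"
    using rel[of "[(GA, True)]" "[(GB, True), (GA, False), (GB, False)] @ c" "(GB, False)"]
      rel[of "[(GA, True), (GB, True)]" "[(GA, False), (GB, False)] @ c" "(GB, True)"] c
    by (cases b) (auto simp: comm_ab_def nielsen_def[of _ _ _ GA] nielsen_def[of _ _ _ GB])
qed

lemma conj_prop_nielsen:
  assumes "(x, y) = (GA, GB) \<or> (x, y) = (GB, GA)" "conj_prop (sub (nielsen x y b) r)"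
  shows "conj_prop r"
proof (rule conj_prop_sub[OF _ _ _ assms(2)])
  show "eqr {rel} (sub (nielsen x y b) rel) []" "eqr {rel} (sub (nielsen x y (\<not> b)) rel) []"
    using assms(1) nielsen_rel by auto
  show "eqr {rel} (sub (nielsen x y (\<not> b)) (nielsen x y b z)) [(z, False)]" for z
    using assms(1) by (intro nielsen_inverse) auto
qed

text \<open>The Euclidean algorithm on the exponent sums in a and b, ending when b has exponent sum
  zero.\<close>

theorem conj_prop_all: "conj_prop r"
proof (induction "nat (\<bar>wt (ind GA) r\<bar> + \<bar>wt (ind GB) r\<bar>)" arbitrary: r rule: less_induct)
  case less
  let ?A = "wt (ind GA)" and ?B = "wt (ind GB)"
  let ?f = "\<lambda>b. sub (nielsen GB GA b)" and ?g = "\<lambda>b. sub (nielsen GA GB b)"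
  have zero: "conj_prop r" if "?B r = 0" for r
    using conj_zero_exponent that by (simp add: conj_prop_def)
  have f: "?A (?f b r) = ?A r + (if b then -1 else 1) * ?B r" "?B (?f b r) = ?B r" for b r
    using wt_nielsen[of GB GA] by simp_all
  have g: "?B (?g b r) = ?B r + (if b then -1 else 1) * ?A r" "?A (?g b r) = ?A r" for b r
    using wt_nielsen[of GA GB] by simp_all
  note fI = conj_prop_nielsen[of GB GA, simplified] and gI = conj_prop_nielsen[of GA GB, simplified]
  consider "?B r = 0" | "?A r = 0" | "?A r \<noteq> 0" "?B r \<noteq> 0" "\<bar>?B r\<bar> \<le> \<bar>?A r\<bar>"
    | "?A r \<noteq> 0" "?B r \<noteq> 0" "\<bar>?A r\<bar> \<le> \<bar>?B r\<bar>" by linarith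
  then show ?case
  proof cases
    case 1
    then show ?thesis by (rule zero)
  next
    case 2
    \<comment> \<open>First \<open>?f False\<close> gives a the exponent sum of b, then
      \<open>?g True\<close> subtracts it from that of b.\<close>
    then have "?B (?g True (?f False r)) = 0" by (simp add: f g)
    then show ?thesis by (rule fI[OF gI[OF zero]])
  next
    case 3
    \<comment> \<open>The sign is chosen so that the larger absolute value decreases.\<close>
    define b where "b \<longleftrightarrow> (?A r > 0 \<longleftrightarrow> ?B r > 0)"
    have "\<bar>?A r + (if b then -1 else 1) * ?B r\<bar> < \<bar>?A r\<bar>" using 3 by (auto simp: b_def)
    then have "nat (\<bar>?A (?f b r)\<bar> + \<bar>?B (?f b r)\<bar>) < nat (\<bar>?A r\<bar> + \<bar>?B r\<bar>)"
      unfolding f by linarith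
    then show ?thesis by (rule fI[OF less])
  next
    case 4
    define b where "b \<longleftrightarrow> (?A r > 0 \<longleftrightarrow> ?B r > 0)"
    have "\<bar>?B r + (if b then -1 else 1) * ?A r\<bar> < \<bar>?B r\<bar>" using 4 by (auto simp: b_def)
    then have "nat (\<bar>?A (?g b r)\<bar> + \<bar>?B (?g b r)\<bar>) < nat (\<bar>?A r\<bar> + \<bar>?B r\<bar>)"
      unfolding g by linarith
    then show ?thesis by (rule gI[OF less])
  qed
qed

end

subsection \<open>Presented groups\<close>

text \<open>A derivation may pass through letters outside S. The retraction onto S fixes the
  relators and both end words and turns cancellations of such letters into trivial steps.\<close>

lemma eqr_pres_eq:
  assumes R: "R \<subseteq> words_over S" and eq: "eqr R v w" and vw: "v \<in> words_over S" "w \<in> words_over S"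
  shows "pres_eq S R v w"
proof -
  let ?k = "sub (keepf S)"
  have k: "?k v \<in> words_over S" for v by (auto simp: words_over_def sub_keepf)
  have id: "?k v = v" if "v \<in> words_over S" for v using that by (simp add: words_over_def)
  have "pres_eq S R (?k v) (?k w)" using eq
  proof (induction rule: eqr_induct)
    case (cancel u v l)
    show ?case
    proof (cases "fst l \<in> S")
      case True
      then show ?thesis using pres_eq.cancel[OF k k True, of R u v] by (simp add: sub_keepf)
    next
      case False
      then have "?k (u @ [l, inv_letter l] @ v) = ?k (u @ v)" by (simp add: sub_keepf)
      then show ?thesis by (simp only: pres_eq.refl[OF k])
    qed
  next
    case (relator u v r)
    then have "r \<in> words_over S" using R by blast
    then show ?case using pres_eq.relator[OF k k relator, of u v] id by simp
  qed (auto intro: pres_eq.refl pres_eq.sym pres_eq.trans k)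
  then show ?thesis using id vw by simp
qed

lemma pres_eqD: "pres_eq S R v w \<Longrightarrow> v \<in> words_over S \<and> w \<in> words_over S \<and> eqr R v w"
proof (induction rule: pres_eq.induct)
  case (cancel u v l)
  then show ?case using eqr_cancel[of R u l v] by (auto simp: words_over_def image_Un)
next
  case (relator u v r)
  then show ?case using eqr_relator[of r R u v] by (auto simp: words_over_def image_Un)
qed (auto intro: eqr_sym eqr_trans)

section \<open>The group of word classes\<close>

context
  fixes S :: "'a set" and R :: "'a word set"
  assumes R: "R \<subseteq> words_over S"
begin

abbreviation (input) "cls \<equiv> word_class S R"
abbreviation (input) "G \<equiv> presented_group S R"

lemma mem_cls: "w \<in> words_over S \<Longrightarrow> v \<in> cls w \<longleftrightarrow> v \<in> words_over S \<and> eqr R w v"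
  unfolding word_class_def using eqr_pres_eq[OF R] pres_eqD by blast

lemma cls_eq_iff: "v \<in> words_over S \<Longrightarrow> w \<in> words_over S \<Longrightarrow> cls v = cls w \<longleftrightarrow> eqr R v w"
proof
  assume "v \<in> words_over S" "w \<in> words_over S" "cls v = cls w"
  then show "eqr R v w" using mem_cls[of v w] mem_cls[of w w] by simp
next
  assume "v \<in> words_over S" "w \<in> words_over S" "eqr R v w"
  then have "x \<in> cls v \<longleftrightarrow> x \<in> cls w" for x
    using mem_cls[of v x] mem_cls[of w x] by (metis eqr_sym eqr_trans)
  then show "cls v = cls w" by blast
qed

lemma words_over_append: "u @ v \<in> words_over S \<longleftrightarrow> u \<in> words_over S \<and> v \<in> words_over S"
  by (auto simp: words_over_def)

lemma words_over_winv: "winv u \<in> words_over S \<longleftrightarrow> u \<in> words_over S"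
  by (simp add: words_over_def)

lemma words_over_Nil: "[] \<in> words_over S"
  by (simp add: words_over_def)

lemma carrier_pres: "carrier G = cls ` words_over S" and one_pres: "\<one>\<^bsub>G\<^esub> = cls []"
  by (simp_all add: presented_group_def)

lemma mult_pres:
  assumes u: "u \<in> words_over S" and v: "v \<in> words_over S"
  shows "cls u \<otimes>\<^bsub>G\<^esub> cls v = cls (u @ v)"
proof -
  let ?p = "SOME p. p \<in> cls u" and ?q = "SOME q. q \<in> cls v"
  have "?p \<in> cls u" by (rule someI[of _ u]) (simp add: mem_cls u)
  moreover have "?q \<in> cls v" by (rule someI[of _ v]) (simp add: mem_cls v)
  ultimately have "cls (?p @ ?q) = cls (u @ v)"
    using u v by (simp add: mem_cls cls_eq_iff words_over_append eqr_append eqr_sym)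
  then show ?thesis by (simp add: presented_group_def)
qed

lemmas pres_simps = carrier_pres one_pres mult_pres cls_eq_iff words_over_append words_over_winv words_over_Nil

lemma group_pres: "group G"
proof (rule groupI)
  fix x assume "x \<in> carrier G"
  then obtain u where u: "u \<in> words_over S" "x = cls u" by (auto simp: carrier_pres)
  then show "\<exists>y\<in>carrier G. y \<otimes>\<^bsub>G\<^esub> x = \<one>\<^bsub>G\<^esub>"
    by (intro bexI[of _ "cls (winv u)"]) (auto simp: pres_simps)
qed (auto simp: pres_simps)

lemma inv_pres: "u \<in> words_over S \<Longrightarrow> inv\<^bsub>G\<^esub> (cls u) = cls (winv u)"
  by (rule group.inv_equality[OF group_pres]) (auto simp: pres_simps)

text \<open>The conjugating word may contain letters outside S, so it is first retracted onto
  S.\<close>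

lemma conjugate_pres:
  assumes u: "u \<in> words_over S" and v: "v \<in> words_over S" and conj: "conjw R u v"
  shows "conjugate_in G (cls v) (cls u)"
proof -
  obtain g where g: "eqr R u (g @ v @ winv g)" using conj by (auto simp: conjw_def)
  let ?k = "sub (keepf S)"
  have id: "?k w = w" if "w \<in> words_over S" for w using that by (simp add: words_over_def)
  have k: "?k g \<in> words_over S" by (auto simp: words_over_def sub_keepf)
  have "eqr R (?k u) (?k (g @ v @ winv g))"
    using g by (rule eqr_sub) (use R id in \<open>auto intro!: eqr_rel simp: subset_iff\<close>)
  then have e: "eqr R u (?k g @ v @ winv (?k g))" using u v by (simp add: id)
  have "eqr R (winv (?k g) @ u @ ?k g) (winv (?k g) @ (?k g @ v @ winv (?k g)) @ ?k g)"
    by (rule eqr_context[OF e])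
  also have "eqr R \<dots> (v @ winv (?k g) @ ?k g)"
    using eqr_cancel_words(2)[of R "[]" "?k g" "v @ winv (?k g) @ ?k g"] by simp
  also have "eqr R \<dots> v" using eqr_cancel_words(2)[of R v "?k g" "[]"] by simp
  finally have "eqr R (winv (?k g) @ u @ ?k g) v" .
  then show ?thesis unfolding conjugate_in_def
    using u v k by (intro bexI[of _ "cls (?k g)"]) (auto simp: pres_simps inv_pres eqr_sym)
qed

text \<open>The classes of words that become trivial once r is added as a relator form a normal
  subgroup containing the class of r, so the normal closure lies inside it.\<close>

lemma normal_closure_pres:
  assumes r: "r \<in> words_over S" and s: "s \<in> words_over S" and "cls s \<in> normal_closure G (cls r)"
  shows "eqr (insert r R) s []"
proof -
  interpret group G by (rule group_pres)
  let ?N = "{cls w | w. w \<in> words_over S \<and> eqr (insert r R) w []}"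
  have mono: "eqr R u v \<Longrightarrow> eqr (insert r R) u v" for u v by (erule eqr_mono) auto
  have app: "eqr (insert r R) (u @ v) []" if "eqr (insert r R) u []" "eqr (insert r R) v []" for u v
    using eqr_append[OF that] by simp
  have wi: "eqr (insert r R) (winv u) []" if "eqr (insert r R) u []" for u
    using eqr_winv[OF that] by simp
  have "subgroup ?N G"
  proof (rule subgroupI)
    show "?N \<subseteq> carrier G" by (auto simp: carrier_pres)
    show "?N \<noteq> {}" using words_over_Nil by blast
    show "inv\<^bsub>G\<^esub> a \<in> ?N" if a: "a \<in> ?N" for a
    proof -
      obtain w where "w \<in> words_over S" "eqr (insert r R) w []" "a = cls w" using a by blast
      then have "inv\<^bsub>G\<^esub> a = cls (winv w) \<and> winv w \<in> words_over S \<and> eqr (insert r R) (winv w) []"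
        using wi by (simp add: inv_pres words_over_winv)
      then show ?thesis by blast
    qed
    show "a \<otimes>\<^bsub>G\<^esub> b \<in> ?N" if "a \<in> ?N" "b \<in> ?N" for a b
      using that app by (auto simp: mult_pres) (metis words_over_append)
  qed
  moreover have "x \<otimes>\<^bsub>G\<^esub> h \<otimes>\<^bsub>G\<^esub> inv\<^bsub>G\<^esub> x \<in> ?N" if xh: "x \<in> carrier G" "h \<in> ?N" for x h
  proof -
    obtain u w where u: "u \<in> words_over S" "x = cls u"
      and w: "w \<in> words_over S" "eqr (insert r R) w []" "h = cls w"
      using xh by (auto simp: carrier_pres)
    have "x \<otimes>\<^bsub>G\<^esub> h \<otimes>\<^bsub>G\<^esub> inv\<^bsub>G\<^esub> x = cls (u @ w @ winv u)"
      using u w by (simp add: inv_pres mult_pres words_over_append words_over_winv)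
    moreover have "eqr (insert r R) (u @ w @ winv u) []"
      using conjw_triv[OF conjw_conj w(2)] .
    ultimately show ?thesis using u w by (auto simp: words_over_append words_over_winv)
  qed
  ultimately have "normal ?N G" by (simp add: normal_inv_iff)
  moreover have "cls r \<in> ?N" using r eqr_rel[of r "insert r R"] by auto
  ultimately have "cls s \<in> ?N" using assms(3) by (auto simp: normal_closure_def)
  then obtain w where w: "w \<in> words_over S" "eqr (insert r R) w []" "cls s = cls w" by blast
  then have "eqr R s w" using s by (simp add: cls_eq_iff)
  then show ?thesis using mono w(2) eqr_trans by blast
qed

lemma mem_normal_closure: "x \<in> carrier G \<Longrightarrow> x \<in> normal_closure G x"
  by (simp add: normal_closure_def)

end

theorem mainTheorem1:
  fixes e :: nat and u v :: "gen word" and r s :: "gen word set"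
  assumes "e \<ge> 2"
    and "u \<noteq> []" and "v \<noteq> []"
    and "reduced u" and "reduced v"
    and "fst ` set u \<subseteq> GY ` {1..e}" and "fst ` set v \<subseteq> GY ` {1..e}"
    and "fst ` set u \<inter> fst ` set v = {}"
    and "r \<in> carrier (presented_group (gens e) {comm_ab @ u @ v})"
    and "s \<in> carrier (presented_group (gens e) {comm_ab @ u @ v})"
    and "normal_closure (presented_group (gens e) {comm_ab @ u @ v}) r
       = normal_closure (presented_group (gens e) {comm_ab @ u @ v}) s"
  shows "conjugate_in (presented_group (gens e) {comm_ab @ u @ v}) r s \<or>
         conjugate_in (presented_group (gens e) {comm_ab @ u @ v}) r
           (inv\<^bsub>presented_group (gens e) {comm_ab @ u @ v}\<^esub> s)"
proof -
  let ?S = "gens e" and ?rel = "comm_ab @ u @ v"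
  interpret commutator_relator "u @ v"
    by unfold_locales (use assms(6,7) in \<open>auto simp: image_Un\<close>)
  have R: "{?rel} \<subseteq> words_over ?S"
    using assms(6,7) by (auto simp: words_over_def gens_def comm_ab_def image_Un)
  obtain r' s' where r': "r' \<in> words_over ?S" "r = word_class ?S {?rel} r'"
    and s': "s' \<in> words_over ?S" "s = word_class ?S {?rel} s'"
    using assms(9,10) by (auto simp: carrier_pres[OF R])
  have "s \<in> normal_closure (presented_group ?S {?rel}) r" "r \<in> normal_closure (presented_group ?S {?rel}) s"
    using mem_normal_closure[OF R] assms(9-11) by blast+
  then have "eqr {r', ?rel} s' []" "eqr {s', ?rel} r' []"
    using normal_closure_pres[OF R] r' s' by auto
  then have "conjw {?rel} s' r' \<or> conjw {?rel} s' (winv r')"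
    using conj_prop_all[of r'] by (simp add: conj_prop_def insert_commute)
  \<comment> \<open>Inverting both words moves the inverse to s', where the conclusion has
    it.\<close>
  then have "conjw {?rel} s' r' \<or> conjw {?rel} (winv s') r'"
    using conjw_winv[of "{?rel}" s' "winv r'"] by auto
  then show ?thesis
    using conjugate_pres[OF R] r' s' by (auto simp: inv_pres[OF R] words_over_winv[OF R])
qed

end
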